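(* Let $q$ be a potential on $[0,\infty)$ with spectral function $\rho$ (for the boundary condition $y(0)=1$, $y'(0)=0$), let $\omega$ be the associated function, assumed to be a measure, and assume that $f(x,y)=\partial^2F/\partial x\,\partial y$ is given by $$f(x,y)=\int_{-\infty}^{+\infty}\cos(\sqrt{\mu}\,x)\cos(\sqrt{\mu}\,y)\,d\omega(\mu).$$ Then $$K(x,y)=-\int_{-\infty}^{+\infty}\phi(x,\lambda)\cos(\sqrt{\lambda}\,y)\,d\omega(\lambda),$$ where $\phi(x,\lambda)$ is the solution of $-y''+q(x)y=\lambda y$ satisfying $\phi(0,\lambda)=1$, $\phi'(0,\lambda)=0$, and $K$ is the Gelfand–Levitan kernel.
   Context: $q$ is continuous on each finite interval of $[0,\infty)$. A spectral function is a nondecreasing $\rho$ on $\mathbb R$ such that for each $g\in L_2(0,\infty)$ the functions $E_n(\lambda)=\int_0^n g(x)\phi(x,\lambda)\,dx$ converge in $L^2(d\rho)$ to a function $E$ with $\int_{\mathbb R}E^2\,d\rho=\int_0^\infty g^2\,dx$. Put $\omega(\lambda)=\rho(\lambda)-\frac2\pi\sqrt\lambda$ for $\lambda>0$, $\omega(\lambda)=\rho(\lambda)$ for $\lambda<0$, and $F(x,y)=\int_{\mathbb R}\frac{\sin(\sqrt\lambda x)\sin(\sqrt\lambda y)}{\lambda}\,d\omega(\lambda)$. For negative $\lambda$, $\cos(\sqrt\lambda x)$ means $\cosh(\sqrt{|\lambda|}x)$, and similarly for the sine. The Gelfand–Levitan kernel $K(x,t)$ ($0\le t\le x$) is the continuous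 kernel in the representation $$\phi(x,\lambda)=\cos(\sqrt\lambda\,x)+\int_0^xK(x,t)\cos(\sqrt\lambda\,t)\,dt ;$$ by Gelfand–Levitan theory it is the (unique) solution of the Gelfand–Levitan equation $$f(x,y)+K(x,y)+\int_0^xK(x,t)f(t,y)\,dt=0 .$$ *)

theory Defs
  imports "HOL-Analysis.Analysis"
begin

text \<open>
  \<open>cos_sqrt \<mu> x\<close> is $\cos(\sqrt\mu x)$ and \<open>sinc_sqrt \<mu> x\<close> is $\sin(\sqrt\mu x)/\sqrt\mu$,
  for all real \<open>\<mu>\<close>. With $\sqrt\mu = i\sqrt{|\mu|}$ for \<open>\<mu> < 0\<close> the latter is
  $\sinh(\sqrt{|\mu|}x)/\sqrt{|\mu|}$; at \<open>\<mu> = 0\<close> it takes its limit value \<open>x\<close>. Hence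
  \<open>sinc_sqrt \<mu> x * sinc_sqrt \<mu> y\<close> is $\sin(\sqrt\mu x)\sin(\sqrt\mu y)/\mu$.
\<close>

definition cos_sqrt :: "real \<Rightarrow> real \<Rightarrow> real" where
  "cos_sqrt \<mu> x = (if \<mu> \<ge> 0 then cos (sqrt \<mu> * x) else cosh (sqrt \<bar>\<mu>\<bar> * x))"

definition sinc_sqrt :: "real \<Rightarrow> real \<Rightarrow> real" where
  "sinc_sqrt \<mu> x =
     (if \<mu> > 0 then sin (sqrt \<mu> * x) / sqrt \<mu>
      else if \<mu> = 0 then x
      else sinh (sqrt \<bar>\<mu>\<bar> * x) / sqrt \<bar>\<mu>\<bar>)"

definition solves_ivp :: "(real \<Rightarrow> real) \<Rightarrow> real \<Rightarrow> (real \<Rightarrow> real) \<Rightarrow> bool" where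
  "solves_ivp q \<mu> y \<longleftrightarrow>
     (\<exists>y' y''.
        (\<forall>x\<ge>0. (y has_real_derivative y' x) (at x within {0..}) \<and>
               (y' has_real_derivative y'' x) (at x within {0..}) \<and>
               - y'' x + q x * y x = \<mu> * y x) \<and>
        y 0 = 1 \<and> y' 0 = 0)"

text \<open>
  A nondecreasing function need not be right-continuous, whereas \<^const>\<open>interval_measure\<close>
  expects that; passing to right limits does not change the Lebesgue--Stieltjes measure.
\<close>

definition right_lim :: "(real \<Rightarrow> real) \<Rightarrow> real \<Rightarrow> real" where
  "right_lim h x = Lim (at_right x) h"

definition stieltjes_measure :: "(real \<Rightarrow> real) \<Rightarrow> real measure" where
  "stieltjes_measure \<rho> = interval_measure (right_lim \<rho>)"

definition spectral_function :: "(real \<Rightarrow> real \<Rightarrow> real) \<Rightarrow> (real \<Rightarrow> real) \<Rightarrow> bool" where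
  "spectral_function \<phi> \<rho> \<longleftrightarrow>
     mono \<rho> \<and>
     (\<forall>g \<in> borel_measurable borel.
        set_integrable lborel {0<..} (\<lambda>x. (g x)\<^sup>2) \<longrightarrow>
        (\<exists>E \<in> borel_measurable borel.
           integrable (stieltjes_measure \<rho>) (\<lambda>\<mu>. (E \<mu>)\<^sup>2) \<and>
           (\<lambda>n::nat. \<integral>\<^sup>+\<mu>. ennreal (((LBINT x:{0..real n}. g x * \<phi> x \<mu>) - E \<mu>)\<^sup>2)
                       \<partial>stieltjes_measure \<rho>) \<longlonglongrightarrow> 0 \<and>
           (\<integral>\<mu>. (E \<mu>)\<^sup>2 \<partial>stieltjes_measure \<rho>) = (LBINT x:{0<..}. (g x)\<^sup>2)))"

definition omega_function :: "(real \<Rightarrow> real) \<Rightarrow> real \<Rightarrow> real" where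
  "omega_function \<rho> \<mu> = (if \<mu> > 0 then \<rho> \<mu> - 2 / pi * sqrt \<mu> else \<rho> \<mu>)"

definition signed_measure :: "(real set \<Rightarrow> ereal) \<Rightarrow> bool" where
  "signed_measure W \<longleftrightarrow>
     W {} = 0 \<and>
     ((\<forall>B\<in>sets borel. W B \<noteq> \<infinity>) \<or> (\<forall>B\<in>sets borel. W B \<noteq> -\<infinity>)) \<and>
     (\<forall>A :: nat \<Rightarrow> real set. range A \<subseteq> sets borel \<longrightarrow> disjoint_family A \<longrightarrow>
        (\<lambda>i. W (A i)) sums W (\<Union>i. A i))"

text \<open>
  The values of \<open>h\<close> at isolated points are immaterial; in particular \<open>h\<close> may be undetermined
  at a point, and an atom there is the jump of \<open>h\<close> across that point.
\<close>

definition stieltjes_signed_measure :: "(real \<Rightarrow> real) \<Rightarrow> (real set \<Rightarrow> ereal) \<Rightarrow> bool" where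
  "stieltjes_signed_measure h W \<longleftrightarrow>
     signed_measure W \<and>
     (\<forall>a b. a < b \<longrightarrow> W {a<..b} = ereal (right_lim h b - right_lim h a))"

definition jordan_decomposition ::
    "(real set \<Rightarrow> ereal) \<Rightarrow> real measure \<Rightarrow> real measure \<Rightarrow> bool" where
  "jordan_decomposition W P N \<longleftrightarrow>
     sets P = sets borel \<and> sets N = sets borel \<and>
     (finite_measure P \<or> finite_measure N) \<and>
     (\<exists>D\<in>sets borel. emeasure P (- D) = 0 \<and> emeasure N D = 0) \<and>
     (\<forall>B\<in>sets borel. W B = enn2ereal (emeasure P B) - enn2ereal (emeasure N B))"

text \<open>
  \<open>has_signed_integral W g I\<close>: the integral of \<open>g\<close> with respect to the signed measure \<open>W\<close>
  converges (absolutely, i.e. with respect to the total variation \<open>P + N\<close>) and equals \<open>I\<close>.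
  The Jordan decomposition exists and is unique, so \<open>I\<close> is determined by \<open>W\<close> and \<open>g\<close>.
\<close>

definition has_signed_integral ::
    "(real set \<Rightarrow> ereal) \<Rightarrow> (real \<Rightarrow> real) \<Rightarrow> real \<Rightarrow> bool" where
  "has_signed_integral W g I \<longleftrightarrow>
     (\<exists>P N. jordan_decomposition W P N \<and> integrable P g \<and> integrable N g \<and>
            I = integral\<^sup>L P g - integral\<^sup>L N g)"

definition mixed_partial ::
    "(real \<Rightarrow> real \<Rightarrow> real) \<Rightarrow> (real \<Rightarrow> real \<Rightarrow> real) \<Rightarrow> bool" where
  "mixed_partial F f \<longleftrightarrow>
     (\<exists>Fy. \<forall>x\<ge>0. \<forall>y\<ge>0.
        ((\<lambda>t. F x t) has_real_derivative Fy x y) (at y within {0..}) \<and>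
        ((\<lambda>s. Fy s y) has_real_derivative f x y) (at x within {0..}))"

definition gelfand_levitan_kernel ::
    "(real \<Rightarrow> real \<Rightarrow> real) \<Rightarrow> (real \<Rightarrow> real \<Rightarrow> real) \<Rightarrow> bool" where
  "gelfand_levitan_kernel \<phi> K \<longleftrightarrow>
     continuous_on {(x, t). 0 \<le> t \<and> t \<le> x} (\<lambda>(x, t). K x t) \<and>
     (\<forall>\<mu>. \<forall>x\<ge>0. \<phi> x \<mu> = cos_sqrt \<mu> x + (LBINT t:{0..x}. K x t * cos_sqrt \<mu> t))"

end

theory Submission
  imports Defs "HOL-Probability.Sinc_Integral"
begin

text \<open>
  Finiteness of the integral for \<open>f 0 0\<close> makes \<open>W\<close> a finite signed measure, and that for \<open>f x x\<close>
  gives it all moments \<open>cosh\<^sup>2 (sqrt \<bar>\<mu>\<bar> x)\<close> on the negative half-line, so every integral below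
  converges absolutely. Let \<open>c < a\<close>. Parseval's identity for \<open>\<rho>\<close> says that the transforms of
  bumps at \<open>a\<close> and at \<open>c\<close> are orthogonal. Split \<open>d\<rho> = dW + (2 / pi) d(sqrt \<mu>)\<close>; the transforms
  of the bumps are cosine transforms of the bumps modified by the transpose of \<open>1 + K\<close>, so the second
  part is computed by Parseval's identity for the cosine transform. Shrinking the bumps gives
  \<open>\<integral> \<phi> a \<mu> \<phi> c \<mu> dW + K a c + \<integral>\<^sub>0\<^sup>c K a t K c t dt = 0\<close>. Expanding \<open>\<phi> c \<mu>\<close> turns this into the homogeneous
  Volterra equation \<open>u c + \<integral>\<^sub>0\<^sup>c K c t u t dt = 0\<close> for \<open>u t = \<integral> \<phi> a \<mu> cos_sqrt \<mu> t dW + K a t\<close>,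
  whence \<open>u = 0\<close>. The case \<open>c = a\<close> follows by continuity in \<open>a\<close>.
\<close>

text \<open>Parseval's identity for \<open>\<rho>\<close> speaks only of square-integrable
  functions, so \<open>phi a\<close> is reached as a limit of averages over boxes. Boxes with
  \<open>c < d < a \<le> b\<close> are disjoint, so the indicators drop out of all products, and the
  double average of the kernel stays eventually below the diagonal, where it is continuous; at
  \<open>t = x\<close> its extension by zero jumps. Hence the strict inequality, removed only at the
  end.

  The splitting of \<open>d\<rho>\<close> is delicate since \<open>\<rho>\<close> and
  \<open>(2 / pi) d(sqrt \<mu>)\<close> can both have infinite mass. It is therefore stated without
  subtraction, as an equality of two positive measures: \<open>\<rho>\<close> plus the negative part
  of \<open>W\<close> equals the positive part of \<open>W\<close> plus the free measure. This
  equality also supplies absolute integrability of the product of the two cosine transforms: the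
  product is integrable for \<open>\<rho>\<close> and for both parts of \<open>W\<close>, hence for
  the free measure. So Parseval's identity for the cosine transform is needed only for an integrable
  product, where damping and dominated convergence prove it.\<close>

lemma
  fixes f :: "'a \<Rightarrow> 'b \<Rightarrow> real"
  assumes "sigma_finite_measure M1" "sigma_finite_measure M2"
    and f[measurable]: "(\<lambda>(x, y). f x y) \<in> borel_measurable (M1 \<Otimes>\<^sub>M M2)"
    and a: "integrable M1 a" and b: "integrable M2 b"
    and bound: "\<And>x y. \<bar>f x y\<bar> \<le> a x * b y"
  shows Fubini_product_bound: "(\<integral>y. (\<integral>x. f x y \<partial>M1) \<partial>M2) = (\<integral>x. (\<integral>y. f x y \<partial>M2) \<partial>M1)"
    and integrable_product_bound: "integrable M1 (\<lambda>x. \<integral>y. f x y \<partial>M2)"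
proof -
  interpret M1: sigma_finite_measure M1 by fact
  interpret M2: sigma_finite_measure M2 by fact
  interpret pair_sigma_finite M1 M2 ..
  have [measurable]: "a \<in> borel_measurable M1" "b \<in> borel_measurable M2"
    using a b by auto
  have "integrable (M1 \<Otimes>\<^sub>M M2) (\<lambda>z. a (fst z) * b (snd z))"
    by (rule Fubini_integrable) (use a b in \<open>auto simp: abs_mult\<close>)
  then have "integrable (M1 \<Otimes>\<^sub>M M2) (\<lambda>(x, y). f x y)"
    by (rule Bochner_Integration.integrable_bound)
       (use bound in \<open>auto intro!: AE_I2 order_trans[OF _ abs_ge_self]\<close>)
  then show "(\<integral>y. (\<integral>x. f x y \<partial>M1) \<partial>M2) = (\<integral>x. (\<integral>y. f x y \<partial>M2) \<partial>M1)"
    and "integrable M1 (\<lambda>x. \<integral>y. f x y \<partial>M2)"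
    by (rule Fubini_integral, rule integrable_fst)
qed

section \<open>The cosine transform\<close>

text \<open>The integral may run over the whole line because Parseval's identity is applied to
  functions vanishing off some \<open>{0..A}\<close>. The transform is unnormalized, which puts the
  factor \<open>pi / 2\<close> into that identity.\<close>

definition cosine_transform :: "(real \<Rightarrow> real) \<Rightarrow> real \<Rightarrow> real" where
  "cosine_transform g s = (\<integral>t. g t * cos (s * t) \<partial>lborel)"

lemma borel_measurable_cosine_transform[measurable]:
  assumes [measurable]: "g \<in> borel_measurable borel"
  shows "cosine_transform g \<in> borel_measurable borel"
  unfolding cosine_transform_def by measurable

lemma abs_cosine_transform_le:
  assumes "integrable lborel g"
  shows "\<bar>cosine_transform g s\<bar> \<le> (\<integral>t. \<bar>g t\<bar> \<partial>lborel)"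
proof -
  have "\<bar>cosine_transform g s\<bar> \<le> (\<integral>t. \<bar>g t * cos (s * t)\<bar> \<partial>lborel)"
    unfolding cosine_transform_def by (rule integral_abs_bound)
  also have "\<dots> \<le> (\<integral>t. \<bar>g t\<bar> \<partial>lborel)"
  proof (rule integral_mono)
    have g': "integrable lborel (\<lambda>t. \<bar>g t\<bar>)" using assms by auto
    have [measurable]: "g \<in> borel_measurable borel" using assms by auto
    show "integrable lborel (\<lambda>t. \<bar>g t * cos (s * t)\<bar>)"
      by (rule Bochner_Integration.integrable_bound[OF g'])
         (auto simp: abs_mult intro!: AE_I2 mult_left_le)
  qed (use assms in \<open>auto simp: abs_mult intro!: mult_left_le\<close>)
  finally show ?thesis .
qed

lemma integrable_exp_Ioi:
  fixes e :: real
  assumes "e > 0"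
  shows "integrable lborel (\<lambda>s. indicator {0<..} s * exp (- (s * e)))"
  using integrable_I0i_exp_mscale[OF assms] by (simp add: set_integrable_def)

text \<open>This Laplace transform of the cosine is the Poisson kernel of the half-plane up to the
  factor \<open>pi\<close>; it is how damping the frequency integral produces an approximate
  identity.\<close>

lemma integral_exp_cos:
  fixes e a :: real
  assumes e: "e > 0"
  shows "(\<integral>s. indicator {0<..} s * exp (- (s * e)) * cos (s * a) \<partial>lborel) = e / (e\<^sup>2 + a\<^sup>2)"
proof -
  \<comment> \<open>Real part of the primitive \<open>- exp (- (e - i a) s) / (e - i a)\<close> of
    \<open>exp (- (e - i a) s)\<close>.\<close>
  define F where "F s = exp (- (s * e)) * (a * sin (s * a) - e * cos (s * a)) / (e\<^sup>2 + a\<^sup>2)" for s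
  let ?f = "\<lambda>s. indicator {0..} s * exp (- (s * e)) * cos (s * a)"
  have pos: "e\<^sup>2 + a\<^sup>2 > 0"
    using e by (simp add: add_pos_nonneg)
  \<comment> \<open>The closed half-line meets \<open>{..b}\<close> in \<open>{0..b}\<close>, the
    form required by the fundamental theorem of calculus; the added point is null.\<close>
  have eq: "AE s in lborel. indicator {0<..} s * exp (- (s * e)) * cos (s * a) = ?f s"
    using AE_lborel_singleton[of "0::real"] by eventually_elim (auto split: split_indicator)
  have "integrable lborel (\<lambda>s. indicator {0<..} s * exp (- (s * e)) * cos (s * a))"
    by (rule Bochner_Integration.integrable_bound[OF integrable_exp_Ioi[OF e]])
       (auto simp: abs_mult intro!: AE_I2 mult_left_le)
  then have int: "integrable lborel ?f"
    by (subst (asm) integrable_cong_AE[OF _ _ eq]) auto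
  have F': "(F has_real_derivative exp (- (s * e)) * cos (s * a)) (at s)" for s
  proof -
    have "((\<lambda>s. exp (- (s * e)) * (a * sin (s * a) - e * cos (s * a))) has_real_derivative
        exp (- (s * e)) * ((e\<^sup>2 + a\<^sup>2) * cos (s * a))) (at s)"
      by (auto intro!: derivative_eq_intros simp: algebra_simps power2_eq_square)
    from DERIV_cdivide[OF this, of "e\<^sup>2 + a\<^sup>2"] show ?thesis
      using pos unfolding F_def[abs_def] by (simp del: sum_power2_eq_zero_iff)
  qed
  have fin: "(\<integral>s. indicator {..b} s *\<^sub>R ?f s \<partial>lborel) = F b - F 0" if "b \<ge> 0" for b
  proof -
    have "(\<integral>s. indicator {..b} s *\<^sub>R ?f s \<partial>lborel)
        = (\<integral>s. exp (- (s * e)) * cos (s * a) * indicator {0..b} s \<partial>lborel)"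
      by (rule Bochner_Integration.integral_cong) (auto split: split_indicator)
    also have "\<dots> = F b - F 0"
      by (rule integral_FTC_Icc_real) (use that F' in auto)
    finally show ?thesis .
  qed
  have "((\<lambda>b. \<integral>s. indicator {..b} s *\<^sub>R ?f s \<partial>lborel) \<longlongrightarrow> integral\<^sup>L lborel ?f) at_top"
    by (rule tendsto_integral_at_top) (use int in auto)
  moreover have "eventually (\<lambda>b. (\<integral>s. indicator {..b} s *\<^sub>R ?f s \<partial>lborel) = F b - F 0) at_top"
    using eventually_ge_at_top[of 0] by eventually_elim (rule fin)
  ultimately have lim: "((\<lambda>b. F b - F 0) \<longlongrightarrow> integral\<^sup>L lborel ?f) at_top"
    using tendsto_cong by force
  have "(F \<longlongrightarrow> 0) at_top"
  proof (rule Lim_null_comparison)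
    have "norm (F b) \<le> exp (- (b * e)) * ((\<bar>a\<bar> + e) / (e\<^sup>2 + a\<^sup>2))" for b
    proof -
      have "\<bar>a * sin (b * a) - e * cos (b * a)\<bar> \<le> \<bar>a * sin (b * a)\<bar> + \<bar>e * cos (b * a)\<bar>"
        by (rule abs_triangle_ineq4)
      also have "\<dots> \<le> \<bar>a\<bar> + e"
        using e by (auto simp: abs_mult intro!: add_mono mult_left_le)
      finally have "exp (- (b * e)) * (\<bar>a * sin (b * a) - e * cos (b * a)\<bar> / (e\<^sup>2 + a\<^sup>2))
          \<le> exp (- (b * e)) * ((\<bar>a\<bar> + e) / (e\<^sup>2 + a\<^sup>2))"
        using pos by (intro mult_left_mono divide_right_mono) auto
      then show ?thesis
        using pos by (simp add: F_def abs_mult)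
    qed
    then show "eventually (\<lambda>b. norm (F b) \<le> exp (- (b * e)) * ((\<bar>a\<bar> + e) / (e\<^sup>2 + a\<^sup>2))) at_top"
      by auto
    have "((\<lambda>b. exp (- (b * e))) \<longlongrightarrow> 0) at_top"
      using e
      by (auto intro!: exp_at_bot[THEN filterlim_compose] filterlim_tendsto_pos_mult_at_top
          filterlim_ident simp: filterlim_uminus_at_bot mult.commute[of _ e])
    then show "((\<lambda>b. exp (- (b * e)) * ((\<bar>a\<bar> + e) / (e\<^sup>2 + a\<^sup>2))) \<longlongrightarrow> 0) at_top"
      by (rule tendsto_mult_left_zero)
  qed
  then have "((\<lambda>b. F b - F 0) \<longlongrightarrow> 0 - F 0) at_top"
    by (intro tendsto_intros)
  then have "integral\<^sup>L lborel ?f = - F 0"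
    using lim tendsto_unique trivial_limit_at_top_linorder by fastforce
  also have "- F 0 = e / (e\<^sup>2 + a\<^sup>2)"
    by (simp add: F_def)
  finally show ?thesis
    by (subst integral_cong_AE[OF _ _ eq]) auto
qed

section \<open>The Cauchy kernel as an approximate identity\<close>

lemma
  shows integrable_cauchy: "integrable lborel (\<lambda>z::real. 1 / (1 + z\<^sup>2))"
    and integral_cauchy: "(\<integral>z. 1 / (1 + (z::real)\<^sup>2) \<partial>lborel) = pi"
  using integrable_inverse_1_plus_square LBINT_inverse_1_plus_square
  by (simp_all add: set_integrable_def interval_lebesgue_integral_def set_lebesgue_integral_def
      divide_inverse)

text \<open>Substituting \<open>y = x + e * z\<close> moves \<open>e\<close> from the kernel into
  the argument of \<open>h\<close>. The kernel is then fixed, and one majorant serves for all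
  \<open>e\<close>.\<close>

lemma cauchy_kernel_rescale:
  fixes h :: "real \<Rightarrow> real"
  assumes e_pos: "e > 0"
  shows "(\<integral>y. h y * (e / (e\<^sup>2 + (y - x)\<^sup>2)) \<partial>lborel)
      = (\<integral>z. h (x + e * z) * (1 / (1 + z\<^sup>2)) \<partial>lborel)"
proof -
  have "(\<integral>y. h y * (e / (e\<^sup>2 + (y - x)\<^sup>2)) \<partial>lborel)
      = (\<integral>z. e * (h (x + e * z) * (e / (e\<^sup>2 + (e * z)\<^sup>2))) \<partial>lborel)"
    unfolding integral_mult_right_zero
    using e_pos by (subst lborel_integral_real_affine[of e _ x]) auto
  also have "\<dots> = (\<integral>z. h (x + e * z) * (1 / (1 + z\<^sup>2)) \<partial>lborel)"
  proof (rule Bochner_Integration.integral_cong)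
    fix z
    have "e\<^sup>2 + (e * z)\<^sup>2 = e\<^sup>2 * (1 + z\<^sup>2)"
      by (simp add: power_mult_distrib algebra_simps)
    then show "e * (h (x + e * z) * (e / (e\<^sup>2 + (e * z)\<^sup>2))) = h (x + e * z) * (1 / (1 + z\<^sup>2))"
      using e_pos by (simp add: power2_eq_square)
  qed simp
  finally show ?thesis .
qed

lemma abs_mult_cauchy_le: "\<bar>y\<bar> \<le> B \<Longrightarrow> \<bar>y * (1 / (1 + z\<^sup>2))\<bar> \<le> B * (1 / (1 + z\<^sup>2))" for y z B :: real
  by (auto simp: abs_mult intro!: mult_right_mono divide_right_mono)

text \<open>The bound is uniform in \<open>e\<close> and \<open>x\<close>, as the domination in the
  proof of Parseval's identity requires.\<close>

lemma abs_cauchy_integral_le: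
  fixes h :: "real \<Rightarrow> real"
  assumes [measurable]: "h \<in> borel_measurable borel"
    and bound: "\<And>t. \<bar>h t\<bar> \<le> B" and e_pos: "e > 0"
  shows "\<bar>\<integral>y. h y * (e / (e\<^sup>2 + (y - x)\<^sup>2)) \<partial>lborel\<bar> \<le> pi * B"
proof -
  let ?k = "\<lambda>z::real. 1 / (1 + z\<^sup>2)"
  have kB: "integrable lborel (\<lambda>z. B * ?k z)"
    using integrable_cauchy by (rule integrable_mult_right)
  have norm: "\<bar>h (x + e * z) * ?k z\<bar> \<le> B * ?k z" for z
    by (rule abs_mult_cauchy_le[OF bound])
  have "\<bar>\<integral>z. h (x + e * z) * ?k z \<partial>lborel\<bar> \<le> (\<integral>z. \<bar>h (x + e * z) * ?k z\<bar> \<partial>lborel)"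
    by (rule integral_abs_bound)
  also have "\<dots> \<le> (\<integral>z. B * ?k z \<partial>lborel)"
  proof (rule integral_mono[OF _ kB norm])
    show "integrable lborel (\<lambda>z. \<bar>h (x + e * z) * ?k z\<bar>)"
    proof (rule Bochner_Integration.integrable_bound[OF kB])
      show "AE z in lborel. norm \<bar>h (x + e * z) * ?k z\<bar> \<le> norm (B * ?k z)"
        unfolding real_norm_def abs_idempotent
        by (intro AE_I2 order_trans[OF norm abs_ge_self])
    qed measurable
  qed
  finally show ?thesis
    unfolding cauchy_kernel_rescale[OF e_pos]
    by (simp only: integral_mult_right_zero integral_cauchy mult.commute)
qed

text \<open>After rescaling, the argument of \<open>h\<close> tends to \<open>x\<close> for every
  fixed \<open>z\<close>, so continuity at the single point \<open>x\<close> suffices. The factor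
  \<open>pi\<close> is the total mass of the Cauchy kernel.\<close>

lemma cauchy_approximate_identity:
  fixes h :: "real \<Rightarrow> real"
  assumes [measurable]: "h \<in> borel_measurable borel"
    and bound: "\<And>t. \<bar>h t\<bar> \<le> B" and cont: "isCont h x" and e: "e \<longlonglongrightarrow> 0"
    and e_pos: "\<And>n. e n > 0"
  shows "(\<lambda>n. \<integral>y. h y * (e n / ((e n)\<^sup>2 + (y - x)\<^sup>2)) \<partial>lborel) \<longlonglongrightarrow> pi * h x"
proof -
  let ?k = "\<lambda>z::real. 1 / (1 + z\<^sup>2)"
  have kB: "integrable lborel (\<lambda>z. B * ?k z)"
    using integrable_cauchy by (rule integrable_mult_right)
  have "(\<lambda>n. \<integral>z. h (x + e n * z) * ?k z \<partial>lborel) \<longlonglongrightarrow> (\<integral>z. h x * ?k z \<partial>lborel)"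
  proof (rule integral_dominated_convergence[OF _ _ kB])
    show "AE z in lborel. (\<lambda>n. h (x + e n * z) * ?k z) \<longlonglongrightarrow> h x * ?k z"
    proof (intro AE_I2 tendsto_mult_right)
      fix z
      have "(\<lambda>n. x + e n * z) \<longlonglongrightarrow> x"
        using tendsto_add[OF tendsto_const tendsto_mult_left_zero[OF e]] by auto
      then show "(\<lambda>n. h (x + e n * z)) \<longlonglongrightarrow> h x"
        using cont isCont_tendsto_compose by blast
    qed
    show "AE z in lborel. norm (h (x + e n * z) * ?k z) \<le> B * ?k z" for n
      unfolding real_norm_def by (intro AE_I2 abs_mult_cauchy_le bound)
  qed measurable
  then show ?thesis
    unfolding cauchy_kernel_rescale[OF e_pos]
    by (simp only: integral_mult_right_zero integral_cauchy mult.commute)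
qed

lemma integrable_indicator_Icc_mult: "integrable lborel (\<lambda>t. indicator {a..b::real} t * c :: real)"
  by (intro integrable_mult_left integrable_real_indicator) (auto simp: emeasure_lborel_Icc_eq)

lemma integrable_bounded_support:
  fixes g :: "real \<Rightarrow> real"
  assumes [measurable]: "g \<in> borel_measurable borel"
    and bound: "\<And>t. \<bar>g t\<bar> \<le> B" and supp: "\<And>t. t \<notin> {a..b} \<Longrightarrow> g t = 0"
  shows "integrable lborel g"
proof -
  show ?thesis
    by (rule Bochner_Integration.integrable_bound[OF integrable_indicator_Icc_mult[of a b B]])
       (use bound supp in \<open>auto intro!: AE_I2 order_trans[OF _ abs_ge_self] split: split_indicator\<close>)
qed

text \<open>
  Multiplying the integrand by \<open>exp (- e s)\<close> turns it into a double integral of \<open>g x * h y\<close>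
  against Poisson kernels.
\<close>

lemma cosine_transform_parseval:
  fixes g h :: "real \<Rightarrow> real"
  assumes g_meas[measurable]: "g \<in> borel_measurable borel"
    and h_meas[measurable]: "h \<in> borel_measurable borel"
    and g_bound: "\<And>t. \<bar>g t\<bar> \<le> B" and h_bound: "\<And>t. \<bar>h t\<bar> \<le> B"
    and g_supp: "\<And>t. t \<notin> {0..A} \<Longrightarrow> g t = 0" and h_supp: "\<And>t. t \<notin> {0..A} \<Longrightarrow> h t = 0"
    and S: "finite S" "\<And>t. t \<notin> S \<Longrightarrow> isCont h t"
    and int: "integrable lborel (\<lambda>s. indicator {0<..} s * (cosine_transform g s * cosine_transform h s))"
  shows "(\<integral>s. indicator {0<..} s * (cosine_transform g s * cosine_transform h s) \<partial>lborel)
       = pi / 2 * (\<integral>t. g t * h t \<partial>lborel)"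
proof -
  define e where "e n = inverse (real (Suc n))" for n
  have e_pos: "e n > 0" for n by (simp add: e_def)
  have e0: "e \<longlonglongrightarrow> 0" unfolding e_def by (rule LIMSEQ_inverse_real_of_nat)
  let ?w = "\<lambda>n s. indicator {0<..} s * exp (- (s * e n)) :: real"
  have w_int: "integrable lborel (?w n)" for n
    by (rule integrable_exp_Ioi[OF e_pos])
  have g_int: "integrable lborel g" and h_int: "integrable lborel h"
    by (rule integrable_bounded_support; fact)+
  \<comment> \<open>The product formula for \<open>cos (s * x) * cos (s * y)\<close> yields one
    kernel centred at \<open>x\<close> and a reflected one centred at \<open>- x\<close>. For
    \<open>x > 0\<close> the latter disappears in the limit, because \<open>h\<close> vanishes on
    the negative half-line.\<close>
  define J where "J n x = (\<integral>y. h y * (e n / ((e n)\<^sup>2 + (y - x)\<^sup>2)) \<partial>lborel)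
      + (\<integral>y. h y * (e n / ((e n)\<^sup>2 + (y - (- x))\<^sup>2)) \<partial>lborel)" for n x
  have [measurable]: "J n \<in> borel_measurable borel" for n
    unfolding J_def by measurable
  let ?H = "\<integral>t. \<bar>h t\<bar> \<partial>lborel"
  have pint: "integrable lborel (\<lambda>y. h y * (e n / ((e n)\<^sup>2 + (y - x)\<^sup>2)))" for n x
  proof (rule integrable_bounded_support)
    have "e n / ((e n)\<^sup>2 + (y - x)\<^sup>2) \<le> 1 / e n" for y
      using e_pos[of n] frac_le[of "e n" "e n" "e n * e n" "(e n)\<^sup>2 + (y - x)\<^sup>2"]
      by (simp add: power2_eq_square)
    then have "\<bar>e n / ((e n)\<^sup>2 + (y - x)\<^sup>2)\<bar> \<le> 1 / e n" for y
      using e_pos[of n] by simp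
    moreover have "0 \<le> B" using h_bound[of 0] by linarith
    ultimately show "\<bar>h y * (e n / ((e n)\<^sup>2 + (y - x)\<^sup>2))\<bar> \<le> B * (1 / e n)" for y
      unfolding abs_mult by (intro mult_mono h_bound) auto
  qed (use h_supp in auto)
  have inner: "(\<integral>s. ?w n s * cos (s * x) * cosine_transform h s \<partial>lborel) = J n x / 2" for n x
  proof -
    have "(\<integral>s. ?w n s * cos (s * x) * cosine_transform h s \<partial>lborel)
        = (\<integral>s. (\<integral>y. ?w n s * cos (s * x) * (h y * cos (s * y)) \<partial>lborel) \<partial>lborel)"
      unfolding cosine_transform_def by simp
    also have "\<dots> = (\<integral>y. (\<integral>s. ?w n s * cos (s * x) * (h y * cos (s * y)) \<partial>lborel) \<partial>lborel)"
    proof (rule Fubini_product_bound[symmetric, where a = "?w n" and b = "\<lambda>y. \<bar>h y\<bar>"])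
      fix s y
      have "\<bar>cos (s * x) * cos (s * y)\<bar> \<le> 1"
        using mult_mono[of "\<bar>cos (s * x)\<bar>" 1 "\<bar>cos (s * y)\<bar>" 1] by (simp add: abs_mult)
      then have "(?w n s * \<bar>h y\<bar>) * \<bar>cos (s * x) * cos (s * y)\<bar> \<le> (?w n s * \<bar>h y\<bar>) * 1"
        by (intro mult_left_mono) auto
      then show "\<bar>?w n s * cos (s * x) * (h y * cos (s * y))\<bar> \<le> ?w n s * \<bar>h y\<bar>"
        by (simp add: abs_mult mult_ac)
    qed (use w_int h_int in \<open>auto intro: lborel.sigma_finite_measure_axioms\<close>)
    also have "\<dots> = (\<integral>y. (h y * (e n / ((e n)\<^sup>2 + (y - x)\<^sup>2))
        + h y * (e n / ((e n)\<^sup>2 + (y - (- x))\<^sup>2))) / 2 \<partial>lborel)"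
    proof (rule Bochner_Integration.integral_cong[OF refl])
      fix y
      have wc: "integrable lborel (\<lambda>s. ?w n s * cos (s * c))" for c
        by (rule Bochner_Integration.integrable_bound[OF w_int[of n]])
           (auto simp: abs_mult intro!: AE_I2 mult_left_le)
      have "cos (s * x) * cos (s * y) = (cos (s * (y - x)) + cos (s * (y - (-x)))) / 2" for s
        by (simp add: cos_diff cos_add algebra_simps)
      moreover have "v * p * (h y * r) = h y / 2 * (v * c + v * d)" if "p * r = (c + d) / 2" for v p r c d
      proof -
        have "v * p * (h y * r) = h y * v * (p * r)" by simp
        then show ?thesis unfolding that by (simp add: algebra_simps)
      qed
      ultimately have "?w n s * cos (s * x) * (h y * cos (s * y))
          = h y / 2 * (?w n s * cos (s * (y - x)) + ?w n s * cos (s * (y - (-x))))" for s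
        by blast
      then have "(\<integral>s. ?w n s * cos (s * x) * (h y * cos (s * y)) \<partial>lborel)
          = h y / 2 * ((\<integral>s. ?w n s * cos (s * (y - x)) \<partial>lborel)
              + (\<integral>s. ?w n s * cos (s * (y - (-x))) \<partial>lborel))"
        using wc by (simp only: integral_mult_right_zero Bochner_Integration.integral_add)
      also have "\<dots> = h y / 2 * (e n / ((e n)\<^sup>2 + (y - x)\<^sup>2) + e n / ((e n)\<^sup>2 + (y - (-x))\<^sup>2))"
        by (simp only: integral_exp_cos[OF e_pos])
      finally show "(\<integral>s. ?w n s * cos (s * x) * (h y * cos (s * y)) \<partial>lborel)
          = (h y * (e n / ((e n)\<^sup>2 + (y - x)\<^sup>2)) + h y * (e n / ((e n)\<^sup>2 + (y - (- x))\<^sup>2))) / 2"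
        by (simp only: distrib_left times_divide_eq_left add_divide_distrib)
    qed
    also have "\<dots> = J n x / 2"
      unfolding J_def using pint[of n x] pint[of n "- x"] by (simp only: integral_divide_zero
        Bochner_Integration.integral_add)
    finally show ?thesis .
  qed
  have damped: "(\<integral>s. exp (- (s * e n))
        * (indicator {0<..} s * (cosine_transform g s * cosine_transform h s)) \<partial>lborel)
      = (\<integral>x. g x * (J n x / 2) \<partial>lborel)" for n
  proof -
    have "(\<integral>s. exp (- (s * e n))
        * (indicator {0<..} s * (cosine_transform g s * cosine_transform h s)) \<partial>lborel)
        = (\<integral>s. (\<integral>x. ?w n s * cosine_transform h s * (g x * cos (s * x)) \<partial>lborel) \<partial>lborel)"
      unfolding cosine_transform_def[of g] integral_mult_right_zero
      by (intro Bochner_Integration.integral_cong refl) (simp only: mult_ac)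
    also have "\<dots> = (\<integral>x. (\<integral>s. ?w n s * cosine_transform h s * (g x * cos (s * x)) \<partial>lborel) \<partial>lborel)"
    proof (rule Fubini_product_bound[symmetric, where a = "\<lambda>s. ?w n s * ?H" and b = "\<lambda>y. \<bar>g y\<bar>"])
      fix s x
      have "\<bar>cosine_transform h s * cos (s * x)\<bar> \<le> ?H * 1"
        unfolding abs_mult by (intro mult_mono abs_cosine_transform_le h_int) auto
      then have "(?w n s * \<bar>g x\<bar>) * \<bar>cosine_transform h s * cos (s * x)\<bar> \<le> (?w n s * \<bar>g x\<bar>) * (?H * 1)"
        by (intro mult_left_mono) auto
      then show "\<bar>?w n s * cosine_transform h s * (g x * cos (s * x))\<bar> \<le> ?w n s * ?H * \<bar>g x\<bar>"
        by (simp add: abs_mult mult_ac)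
    qed (use w_int g_int in \<open>auto intro: lborel.sigma_finite_measure_axioms\<close>)
    also have "\<dots> = (\<integral>x. g x * (\<integral>s. ?w n s * cos (s * x) * cosine_transform h s \<partial>lborel) \<partial>lborel)"
      unfolding integral_mult_right_zero[symmetric]
      by (intro Bochner_Integration.integral_cong refl) (simp only: mult_ac)
    finally show ?thesis
      by (simp only: inner)
  qed
  have "(\<lambda>n. \<integral>x. g x * (J n x / 2) \<partial>lborel) \<longlonglongrightarrow> (\<integral>x. g x * (pi * h x / 2) \<partial>lborel)"
  proof (rule integral_dominated_convergence)
    show "integrable lborel (\<lambda>x. \<bar>g x\<bar> * (pi * B))"
      using g_int by auto
    show "AE x in lborel. (\<lambda>n. g x * (J n x / 2)) \<longlonglongrightarrow> g x * (pi * h x / 2)"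
    proof -
      \<comment> \<open>At 0 the two kernels concentrate at the same point, and on \<open>S\<close>
        continuity of \<open>h\<close> may fail; a finite set is null.\<close>
      have "AE x in lborel. x \<notin> insert 0 S"
        using S(1) by (intro AE_not_in finite_imp_null_set_lborel) auto
      then show ?thesis
      proof eventually_elim
        case (elim x)
        show ?case
        proof (cases "x > 0")
          case True
          have ev: "\<forall>\<^sub>F t in nhds (- x). h t = 0"
            by (rule eventually_mono[OF eventually_nhds_in_open[of "{..<0}"]]) (use True h_supp in auto)
          have "isCont h (- x)"
            by (subst isCont_cong[where g = "\<lambda>_. 0"]) (use ev in auto)
          from cauchy_approximate_identity(1)[OF h_meas h_bound this e0 e_pos] h_supp[of "-x"] True
          have "(\<lambda>n. \<integral>y. h y * (e n / ((e n)\<^sup>2 + (y - (- x))\<^sup>2)) \<partial>lborel) \<longlonglongrightarrow> 0"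
            by simp
          moreover have "(\<lambda>n. \<integral>y. h y * (e n / ((e n)\<^sup>2 + (y - x)\<^sup>2)) \<partial>lborel) \<longlonglongrightarrow> pi * h x"
            using elim S(2) by (intro cauchy_approximate_identity(1)[OF h_meas h_bound _ e0 e_pos]) auto
          ultimately have "(\<lambda>n. J n x) \<longlonglongrightarrow> pi * h x + 0"
            unfolding J_def by (intro tendsto_add)
          then show ?thesis
            by (intro tendsto_intros) auto
        next
          case False
          then have "g x = 0" using g_supp elim by auto
          then show ?thesis by simp
        qed
      qed
    qed
    show "AE x in lborel. norm (g x * (J n x / 2)) \<le> \<bar>g x\<bar> * (pi * B)" for n
    proof (rule AE_I2)
      fix x
      have "\<bar>\<integral>y. h y * (e n / ((e n)\<^sup>2 + (y - z)\<^sup>2)) \<partial>lborel\<bar> \<le> pi * B" for z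
        by (rule abs_cauchy_integral_le[OF h_meas h_bound e_pos])
      from this[of x] this[of "-x"] have "\<bar>J n x\<bar> \<le> 2 * (pi * B)"
        unfolding J_def by linarith
      then have "\<bar>g x\<bar> * \<bar>J n x / 2\<bar> \<le> \<bar>g x\<bar> * (pi * B)"
        by (intro mult_left_mono) auto
      then show "norm (g x * (J n x / 2)) \<le> \<bar>g x\<bar> * (pi * B)"
        by (simp only: real_norm_def abs_mult)
    qed
  qed auto
  \<comment> \<open>The damping is removed with the undamped integrand as majorant, which is where
    its assumed integrability enters.\<close>
  moreover have "(\<lambda>n. \<integral>s. exp (- (s * e n))
        * (indicator {0<..} s * (cosine_transform g s * cosine_transform h s)) \<partial>lborel)
      \<longlonglongrightarrow> (\<integral>s. indicator {0<..} s * (cosine_transform g s * cosine_transform h s) \<partial>lborel)"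
  proof (rule integral_dominated_convergence[OF _ _ integrable_norm[OF int]])
    show "AE s in lborel. (\<lambda>n. exp (- (s * e n))
        * (indicator {0<..} s * (cosine_transform g s * cosine_transform h s)))
      \<longlonglongrightarrow> indicator {0<..} s * (cosine_transform g s * cosine_transform h s)"
      by (intro AE_I2) (rule tendsto_eq_intros e0 refl | simp)+
    show "AE s in lborel. norm (exp (- (s * e n))
        * (indicator {0<..} s * (cosine_transform g s * cosine_transform h s)))
      \<le> norm (indicator {0<..} s * (cosine_transform g s * cosine_transform h s))" for n
      using e_pos[of n]
      by (intro AE_I2) (auto simp: abs_mult intro!: mult_left_le_one_le split: split_indicator)
  qed auto
  ultimately have "(\<integral>s. indicator {0<..} s * (cosine_transform g s * cosine_transform h s) \<partial>lborel)
      = (\<integral>x. g x * (pi * h x / 2) \<partial>lborel)"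
    unfolding damped using LIMSEQ_unique by blast
  also have "\<dots> = (\<integral>x. pi / 2 * (g x * h x) \<partial>lborel)"
    by (intro Bochner_Integration.integral_cong) auto
  finally show ?thesis
    by simp
qed

section \<open>Sums of measures\<close>

text \<open>Sums of positive measures allow the splitting of \<open>d\<rho>\<close> to be written
  without subtraction. \<open>measure_of\<close> gives the intended values only if the set function
  is a measure, hence the condition \<open>sets A = sets B\<close> in the lemmas below.\<close>

definition add_measure :: "'a measure \<Rightarrow> 'a measure \<Rightarrow> 'a measure" where
  "add_measure A B = measure_of (space A) (sets A) (\<lambda>X. emeasure A X + emeasure B X)"

lemma sets_add_measure[simp, measurable_cong]: "sets (add_measure A B) = sets A"
  by (simp add: add_measure_def)

lemma emeasure_add_measure:
  assumes "sets A = sets B" and X: "X \<in> sets A"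
  shows "emeasure (add_measure A B) X = emeasure A X + emeasure B X"
  unfolding add_measure_def
proof (rule emeasure_measure_of_sigma[OF sets.sigma_algebra_axioms _ _ X])
  show "positive (sets A) (\<lambda>X. emeasure A X + emeasure B X)"
    by (simp add: positive_def)
  show "countably_additive (sets A) (\<lambda>X. emeasure A X + emeasure B X)"
    using assms(1)
    by (auto simp: countably_additive_def suminf_add[symmetric] suminf_emeasure)
qed

text \<open>Induction on the measurable function. In the step to monotone limits, the two integrals
  increase along the same sequence, and this lets the supremum commute with the sum.\<close>

lemma nn_integral_add_measure:
  assumes sets: "sets A = sets B" and f: "f \<in> borel_measurable A"
  shows "nn_integral (add_measure A B) f = nn_integral A f + nn_integral B f"
proof -
  have space: "space A = space B" "space (add_measure A B) = space A"
    using sets_eq_imp_space_eq[OF sets] sets_eq_imp_space_eq[OF sets_add_measure[of A B]] by auto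
  have B: "g \<in> borel_measurable B \<longleftrightarrow> g \<in> borel_measurable A" for g :: "_ \<Rightarrow> ennreal"
    using measurable_cong_sets[OF sets refl] by blast
  have C: "g \<in> borel_measurable (add_measure A B) \<longleftrightarrow> g \<in> borel_measurable A" for g :: "_ \<Rightarrow> ennreal"
    using measurable_cong_sets[OF sets_add_measure refl] by blast
  show ?thesis
    using f
  proof (induction rule: borel_measurable_induct)
    case (cong f g)
    then have "nn_integral M f = nn_integral M g" if "space M = space A" for M
      using that by (intro nn_integral_cong) auto
    then show ?case
      using cong space by metis
  next
    case (set X)
    then show ?case
      using sets by (simp add: emeasure_add_measure)
  next
    case (mult u c)
    then show ?case
      by (simp add: nn_integral_cmult B C distrib_left)
  next
    case (add u v)
    then show ?case
      by (simp add: nn_integral_add B C algebra_simps)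
  next
    case (seq U)
    have "nn_integral M (SUP i. U i) = (SUP i. nn_integral M (U i))"
      if "\<And>i. U i \<in> borel_measurable M" for M
    proof -
      have "(SUP i. U i) = (\<lambda>x. SUP i. U i x)"
        by (simp add: fun_eq_iff image_comp)
      then show ?thesis
        using that seq.hyps(3) by (simp only: nn_integral_monotone_convergence_SUP)
    qed
    moreover have "incseq (\<lambda>i. nn_integral M (U i))" for M
      using seq.hyps(3) by (auto simp: incseq_def le_fun_def intro!: nn_integral_mono)
    ultimately show ?case
      using seq.hyps(1) seq.IH
      by (simp only: B C ennreal_SUP_add)
  qed
qed

lemma
  fixes f :: "'a \<Rightarrow> real"
  assumes sets: "sets A = sets B"
  shows integrable_add_measure: "integrable (add_measure A B) f \<longleftrightarrow> integrable A f \<and> integrable B f"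
    and integral_add_measure: "integrable A f \<Longrightarrow> integrable B f \<Longrightarrow>
      integral\<^sup>L (add_measure A B) f = integral\<^sup>L A f + integral\<^sup>L B f"
proof -
  have B: "f \<in> borel_measurable B \<longleftrightarrow> f \<in> borel_measurable A"
    using measurable_cong_sets[OF sets refl] by blast
  have C: "f \<in> borel_measurable (add_measure A B) \<longleftrightarrow> f \<in> borel_measurable A"
    using measurable_cong_sets[OF sets_add_measure refl] by blast
  have nn: "nn_integral (add_measure A B) (\<lambda>x. ennreal (g x))
      = nn_integral A (\<lambda>x. ennreal (g x)) + nn_integral B (\<lambda>x. ennreal (g x))"
    if "g \<in> borel_measurable A" for g
    using that by (intro nn_integral_add_measure[OF sets]) auto
  show iff: "integrable (add_measure A B) f \<longleftrightarrow> integrable A f \<and> integrable B f"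
  proof (cases "f \<in> borel_measurable A")
    case True
    then show ?thesis
      by (simp add: integrable_iff_bounded B C nn)
  qed (auto dest: borel_measurable_integrable simp: B C)
  assume int: "integrable A f" "integrable B f"
  then have fA: "f \<in> borel_measurable A" by auto
  have fin: "nn_integral M (\<lambda>x. ennreal (f x)) < top" "nn_integral M (\<lambda>x. ennreal (- f x)) < top"
    if "integrable M f" for M
    using that unfolding real_integrable_def less_top[symmetric] by auto
  show "integral\<^sup>L (add_measure A B) f = integral\<^sup>L A f + integral\<^sup>L B f"
    unfolding real_lebesgue_integral_def[OF int(1)] real_lebesgue_integral_def[OF int(2)]
      real_lebesgue_integral_def[OF iff[THEN iffD2, OF conjI, OF int]]
      nn[OF fA] nn[OF borel_measurable_uminus[OF fA]]
      enn2real_plus[OF fin(1)[OF int(1)] fin(1)[OF int(2)]]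
      enn2real_plus[OF fin(2)[OF int(1)] fin(2)[OF int(2)]]
    by simp
qed

section \<open>Lebesgue--Stieltjes measures\<close>

text \<open>\<open>Lim\<close> selects a value whether or not a limit exists, so existence has to be
  established: a monotone function tends to its infimum over the points to the right.\<close>

lemma tendsto_right_lim:
  assumes "mono h"
  shows "(h \<longlongrightarrow> right_lim h x) (at_right x)"
proof -
  have "(h \<longlongrightarrow> Inf (h ` ({x<..} \<inter> UNIV))) (at x within ({x<..} \<inter> UNIV))"
    by (rule Lim_right_bound[where K = "h x"]) (auto intro: monoD[OF assms])
  then show ?thesis
    unfolding right_lim_def by (simp add: tendsto_Lim)
qed

lemma
  assumes "mono h"
  shows right_lim_ge: "h x \<le> right_lim h x"
    and right_lim_le: "x < y \<Longrightarrow> right_lim h x \<le> h y"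
proof -
  note lim = tendsto_right_lim[OF assms, of x]
  have "eventually (\<lambda>t. h x \<le> h t) (at_right x)"
    using eventually_at_right_less by eventually_elim (auto intro: monoD[OF assms])
  then show "h x \<le> right_lim h x"
    by (rule tendsto_lowerbound[OF lim]) simp
  assume "x < y"
  then have "eventually (\<lambda>t. t \<in> {x<..<y}) (at_right x)"
    by (rule eventually_at_right_real)
  then have "eventually (\<lambda>t. h t \<le> h y) (at_right x)"
    by eventually_elim (auto intro: monoD[OF assms])
  then show "right_lim h x \<le> h y"
    by (rule tendsto_upperbound[OF lim]) simp
qed

lemma mono_right_lim:
  assumes "mono h"
  shows "mono (right_lim h)"
proof (rule monoI)
  fix x y :: real
  assume "x \<le> y"
  then show "right_lim h x \<le> right_lim h y"
    using right_lim_ge[OF assms, of y] right_lim_le[OF assms, of x y] by (cases "x = y") auto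
qed

lemma continuous_right_lim:
  assumes "mono h"
  shows "continuous (at_right a) (right_lim h)"
  unfolding continuous_within
proof (rule tendsto_sandwich)
  show "eventually (\<lambda>t. right_lim h a \<le> right_lim h t) (at_right a)"
    using eventually_at_right_less
    by eventually_elim (auto intro: monoD[OF mono_right_lim[OF assms]])
  \<comment> \<open>For \<open>t > a\<close> the point \<open>2 * t - a\<close> lies to the right of
    \<open>t\<close> and still tends to \<open>a\<close> from the right, so a right limit is bounded
    by a value of \<open>h\<close> whose limit is known.\<close>
  show "eventually (\<lambda>t. right_lim h t \<le> h (2 * t - a)) (at_right a)"
    using eventually_at_right_less by eventually_elim (use right_lim_le[OF assms] in auto)
  have "filterlim (\<lambda>t. 2 * t - a) (at_right a) (at_right a)"
  proof (rule tendsto_imp_filterlim_at_right)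
    show "((\<lambda>t. 2 * t - a) \<longlongrightarrow> a) (at_right a)"
      by (auto intro!: tendsto_eq_intros)
    show "eventually (\<lambda>t. 2 * t - a > a) (at_right a)"
      using eventually_at_right_less by eventually_elim auto
  qed
  then show "((\<lambda>t. h (2 * t - a)) \<longlongrightarrow> right_lim h a) (at_right a)"
    by (rule filterlim_compose[OF tendsto_right_lim[OF assms]])
qed simp

lemma emeasure_stieltjes_measure:
  assumes "mono \<rho>" "a \<le> b"
  shows "emeasure (stieltjes_measure \<rho>) {a<..b} = ennreal (right_lim \<rho> b - right_lim \<rho> a)"
  unfolding stieltjes_measure_def
  using assms
  by (intro emeasure_interval_measure_Ioc continuous_right_lim monoD[OF mono_right_lim])

lemma sets_stieltjes_measure[simp, measurable_cong]: "sets (stieltjes_measure \<rho>) = sets borel"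
  by (simp add: stieltjes_measure_def)

text \<open>The subtracted term is continuous and vanishes at 0, so only \<open>\<rho>\<close> feels
  the passage to right limits. At \<open>x = 0\<close> all points to the right already belong to the
  positive branch.\<close>

lemma right_lim_omega_function:
  assumes "mono \<rho>"
  shows "right_lim (omega_function \<rho>) x = right_lim \<rho> x - 2 / pi * sqrt (max 0 x)"
proof -
  have "(omega_function \<rho> \<longlongrightarrow> right_lim \<rho> x - 2 / pi * sqrt (max 0 x)) (at_right x)"
  proof (cases "x < 0")
    case True
    have ev: "eventually (\<lambda>t. omega_function \<rho> t = \<rho> t) (at_right x)"
      using eventually_at_right_real[OF True]
      by eventually_elim (auto simp: omega_function_def)
    then show ?thesis
      using True tendsto_right_lim[OF assms, of x] ev by (simp add: tendsto_cong)
  next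
    case False
    have ev: "eventually (\<lambda>t. omega_function \<rho> t = \<rho> t - 2 / pi * sqrt t) (at_right x)"
      using eventually_at_right_less
      by eventually_elim (use False in \<open>auto simp: omega_function_def\<close>)
    have "((\<lambda>t. \<rho> t - 2 / pi * sqrt t) \<longlongrightarrow> right_lim \<rho> x - 2 / pi * sqrt x) (at_right x)"
      by (intro tendsto_intros tendsto_right_lim assms)
    then show ?thesis
      using False ev by (simp add: tendsto_cong max_def)
  qed
  then show ?thesis
    unfolding right_lim_def by (intro tendsto_Lim) auto
qed

text \<open>The measure \<open>(2 / pi) d(sqrt \<mu>)\<close> on the positive half-line.\<close>

definition free_measure :: "real measure" where
  "free_measure = distr (density lborel (\<lambda>s. ennreal (2 / pi * indicator {0<..} s))) borel (\<lambda>s. s\<^sup>2)"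

lemma sets_free_measure[simp, measurable_cong]: "sets free_measure = sets borel"
  by (simp add: free_measure_def)

lemma emeasure_free_measure:
  assumes "a \<le> b"
  shows "emeasure free_measure {a<..b} = ennreal (2 / pi * (sqrt (max 0 b) - sqrt (max 0 a)))"
proof -
  have mono: "sqrt (max 0 a) \<le> sqrt (max 0 b)"
    using assms by simp
  \<comment> \<open>For \<open>s > 0\<close>, comparing \<open>s\<^sup>2\<close> with an endpoint is
    the same as comparing it with the endpoint clipped at 0, and the clipped one has a real square
    root.\<close>
  have iff: "0 < s \<and> s\<^sup>2 \<in> {a<..b} \<longleftrightarrow> s \<in> {sqrt (max 0 a)<..sqrt (max 0 b)}" for s :: real
  proof (cases "s > 0")
    case True
    then have "s\<^sup>2 > 0" "sqrt (s\<^sup>2) = s" by simp_all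
    then show ?thesis
      using True real_sqrt_less_iff[of "max 0 a" "s\<^sup>2"] real_sqrt_le_iff[of "s\<^sup>2" "max 0 b"] by auto
  next
    case False
    then have "\<not> sqrt (max 0 a) < s"
      using real_sqrt_ge_zero[of "max 0 a"] by linarith
    then show ?thesis
      using False by simp
  qed
  have eq: "ennreal (2 / pi * indicator {0<..} s) * indicator ((\<lambda>s. s\<^sup>2) -` {a<..b}) s
      = ennreal (2 / pi) * indicator {sqrt (max 0 a)<..sqrt (max 0 b)} s" for s :: real
    using iff[of s] by (cases "s > 0"; cases "s\<^sup>2 \<in> {a<..b}") (auto simp: indicator_def)
  have vimage: "(\<lambda>s::real. s\<^sup>2) -` {a<..b} \<in> sets borel"
    by (rule measurable_sets_borel[of _ borel]) auto
  have "emeasure free_measure {a<..b}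
      = (\<integral>\<^sup>+s. ennreal (2 / pi * indicator {0<..} s) * indicator ((\<lambda>s. s\<^sup>2) -` {a<..b}) s \<partial>lborel)"
    unfolding free_measure_def
    using vimage by (subst emeasure_distr) (auto simp: emeasure_density)
  also have "\<dots> = ennreal (2 / pi) * ennreal (sqrt (max 0 b) - sqrt (max 0 a))"
    unfolding eq using mono by (simp add: nn_integral_cmult)
  finally show ?thesis
    using mono by (simp only: ennreal_mult[symmetric] diff_ge_0_iff_ge pi_ge_zero divide_nonneg_nonneg
        zero_le_numeral)
qed

lemma
  fixes j :: "real \<Rightarrow> real"
  assumes [measurable]: "j \<in> borel_measurable borel"
  shows integrable_free_measure:
      "integrable free_measure j \<longleftrightarrow> integrable lborel (\<lambda>s. indicator {0<..} s * j (s\<^sup>2))"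
    and integral_free_measure:
      "integral\<^sup>L free_measure j = 2 / pi * (\<integral>s. indicator {0<..} s * j (s\<^sup>2) \<partial>lborel)"
proof -
  show "integrable free_measure j \<longleftrightarrow> integrable lborel (\<lambda>s. indicator {0<..} s * j (s\<^sup>2))"
    unfolding free_measure_def
    by (subst integrable_distr_eq)
       (auto simp: integrable_density mult.assoc integrable_mult_right_iff
         simp del: times_divide_eq_left)
  show "integral\<^sup>L free_measure j = 2 / pi * (\<integral>s. indicator {0<..} s * j (s\<^sup>2) \<partial>lborel)"
    unfolding free_measure_def
    by (subst integral_distr) (auto simp: integral_density mult.assoc)
qed

section \<open>Signed measures\<close>

text \<open>Minimality of the Jordan decomposition. On its positive set \<open>D\<close> the measure
  \<open>W\<close> coincides with \<open>P\<close>, so there \<open>P = P' - N' \<le> P'\<close>,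
  and \<open>P\<close> has no mass off \<open>D\<close>. The complement of \<open>D\<close> treats
  \<open>N\<close> in the same way.\<close>

lemma jordan_decomposition_le:
  assumes "jordan_decomposition W P N" "jordan_decomposition W P' N'" and B: "B \<in> sets borel"
  shows "emeasure P B \<le> emeasure P' B \<and> emeasure N B \<le> emeasure N' B"
proof -
  obtain D where D[measurable]: "D \<in> sets borel" and PD: "emeasure P (- D) = 0" and ND: "emeasure N D = 0"
    and W: "\<And>B. B \<in> sets borel \<Longrightarrow> W B = enn2ereal (emeasure P B) - enn2ereal (emeasure N B)"
    and PN[measurable_cong]: "sets P = sets borel" "sets N = sets borel"
    using assms(1) by (auto simp: jordan_decomposition_def)
  have W': "\<And>B. B \<in> sets borel \<Longrightarrow> W B = enn2ereal (emeasure P' B) - enn2ereal (emeasure N' B)"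
    and [measurable_cong]: "sets P' = sets borel" "sets N' = sets borel"
    and fin: "finite_measure P' \<or> finite_measure N'"
    using assms(2) by (auto simp: jordan_decomposition_def)
  note B[measurable]
  have zero: "emeasure M (B \<inter> E) = 0" if "emeasure M E = 0" "E \<in> sets M" "sets M = sets borel" for M E
    using emeasure_mono[of "B \<inter> E" E M] that by auto
  have split: "emeasure M B = emeasure M (B \<inter> D) + emeasure M (B \<inter> - D)" if "sets M = sets borel" for M
    using that by (subst plus_emeasure) (auto intro!: arg_cong[where f = "emeasure M"])
  have P: "emeasure P B = emeasure P (B \<inter> D)" and N: "emeasure N B = emeasure N (B \<inter> - D)"
    using split[OF PN(1)] split[OF PN(2)] zero[OF PD _ PN(1)] zero[OF ND _ PN(2)] D PN by auto
  \<comment> \<open>One of the two measures is finite, so the extended-real differences below never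
    read \<open>\<infinity> - \<infinity>\<close>.\<close>
  have P'N': "enn2ereal (emeasure P' X) \<noteq> \<infinity> \<or> enn2ereal (emeasure N' X) \<noteq> \<infinity>" for X
    using fin finite_measure.emeasure_finite[of P' X] finite_measure.emeasure_finite[of N' X]
    by (auto simp: enn2ereal_eq_top_iff)
  have "enn2ereal (emeasure P (B \<inter> D)) = enn2ereal (emeasure P' (B \<inter> D)) - enn2ereal (emeasure N' (B \<inter> D))"
    using W[of "B \<inter> D"] W'[of "B \<inter> D"] zero[OF ND _ PN(2)] D PN by (simp add: zero_ennreal.rep_eq)
  also have "\<dots> \<le> enn2ereal (emeasure P' (B \<inter> D))"
    using P'N'[of "B \<inter> D"] enn2ereal_nonneg[of "emeasure N' (B \<inter> D)"]
    by (cases "enn2ereal (emeasure P' (B \<inter> D))"; cases "enn2ereal (emeasure N' (B \<inter> D))") auto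
  also have "\<dots> \<le> enn2ereal (emeasure P' B)"
    by (simp add: less_eq_ennreal.rep_eq[symmetric] emeasure_mono)
  finally have le: "emeasure P B \<le> emeasure P' B"
    by (simp add: P less_eq_ennreal.rep_eq)
  have "- enn2ereal (emeasure N (B \<inter> - D)) = enn2ereal (emeasure P' (B \<inter> - D)) - enn2ereal (emeasure N' (B \<inter> - D))"
    using W[of "B \<inter> - D"] W'[of "B \<inter> - D"] zero[OF PD _ PN(1)] D PN by (simp add: zero_ennreal.rep_eq)
  then have "enn2ereal (emeasure N (B \<inter> - D)) \<le> enn2ereal (emeasure N' (B \<inter> - D))"
    using P'N'[of "B \<inter> - D"] enn2ereal_nonneg[of "emeasure P' (B \<inter> - D)"]
    by (cases "enn2ereal (emeasure P' (B \<inter> - D))"; cases "enn2ereal (emeasure N' (B \<inter> - D))";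
        cases "enn2ereal (emeasure N (B \<inter> - D))") auto
  also have "\<dots> \<le> enn2ereal (emeasure N' B)"
    by (simp add: less_eq_ennreal.rep_eq[symmetric] emeasure_mono)
  finally have "emeasure N B \<le> emeasure N' B"
    by (simp add: N less_eq_ennreal.rep_eq)
  with le show ?thesis by simp
qed

text \<open>Every \<open>has_signed_integral\<close> brings its own decomposition; uniqueness is
  what lets statements about different integrands refer to one pair \<open>P\<close>,
  \<open>N\<close>.\<close>

lemma jordan_decomposition_unique:
  assumes "jordan_decomposition W P N" "jordan_decomposition W P' N'"
  shows "P = P' \<and> N = N'"
proof -
  have sets: "sets P = sets borel" "sets N = sets borel" "sets P' = sets borel" "sets N' = sets borel"
    using assms by (auto simp: jordan_decomposition_def)
  moreover have "emeasure P B = emeasure P' B \<and> emeasure N B = emeasure N' B" if "B \<in> sets borel" for B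
    using jordan_decomposition_le[OF assms that] jordan_decomposition_le[OF assms(2,1) that]
    by (simp add: eq_iff)
  ultimately show ?thesis
    by (intro conjI measure_eqI) auto
qed

text \<open>The subtraction-free form of \<open>d\<rho> = dW + (2 / pi) d(sqrt \<mu>)\<close>.
  Finiteness of \<open>P\<close> and \<open>N\<close> turns the values of \<open>W\<close> on
  half-open intervals into real differences, which can be rearranged; such intervals generate the
  Borel sets.\<close>

lemma add_measure_stieltjes_eq:
  assumes "mono \<rho>" and W: "stieltjes_signed_measure (omega_function \<rho>) W"
    and jordan: "jordan_decomposition W P N" and "finite_measure P" "finite_measure N"
  shows "add_measure (stieltjes_measure \<rho>) N = add_measure P free_measure"
proof (rule measure_eqI_generator_eq)
  interpret P: finite_measure P by fact
  interpret N: finite_measure N by fact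
  have sets[simp]: "sets P = sets borel" "sets N = sets borel"
    using jordan by (auto simp: jordan_decomposition_def)
  have Ioc: "emeasure (add_measure (stieltjes_measure \<rho>) N) {a<..b}
      = emeasure (add_measure P free_measure) {a<..b}" for a b
  proof (cases "a < b")
    case True
    let ?m = "2 / pi * (sqrt (max 0 b) - sqrt (max 0 a))"
    have "ereal (measure P {a<..b} - measure N {a<..b}) = W {a<..b}"
      using jordan by (simp add: jordan_decomposition_def P.emeasure_eq_measure N.emeasure_eq_measure)
    also have "\<dots> = ereal (right_lim \<rho> b - right_lim \<rho> a - ?m)"
      using W True \<open>mono \<rho>\<close>
      by (simp add: stieltjes_signed_measure_def right_lim_omega_function algebra_simps)
    finally have "right_lim \<rho> b - right_lim \<rho> a + measure N {a<..b} = measure P {a<..b} + ?m"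
      by simp
    moreover have "right_lim \<rho> a \<le> right_lim \<rho> b"
      using True by (intro monoD[OF mono_right_lim[OF \<open>mono \<rho>\<close>]]) simp
    moreover have "0 \<le> ?m"
      using True by simp
    ultimately show ?thesis
      using True \<open>mono \<rho>\<close>
      by (simp add: emeasure_add_measure emeasure_stieltjes_measure emeasure_free_measure
          P.emeasure_eq_measure N.emeasure_eq_measure ennreal_plus[symmetric] del: ennreal_plus)
  qed (simp add: emeasure_add_measure)
  then show "emeasure (add_measure (stieltjes_measure \<rho>) N) X = emeasure (add_measure P free_measure) X"
    if "X \<in> range (\<lambda>(a, b). {a<..b})" for X
    using that by auto
  show "Int_stable (range (\<lambda>(a, b). {a<..b::real}))"
    by (auto simp: Int_stable_def Int_greaterThanAtMost)
  show "range (\<lambda>n::nat. {- real n<..real n}) \<subseteq> range (\<lambda>(a, b). {a<..b})"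
    by auto
  show "(\<Union>n::nat. {- real n<..real n}) = UNIV"
  proof -
    have "\<exists>n::nat. - real n < x \<and> x \<le> real n" for x :: real
      using reals_Archimedean2[of "\<bar>x\<bar>"] by (metis abs_less_iff less_imp_le minus_less_iff)
    then show ?thesis by auto
  qed
  show "emeasure (add_measure (stieltjes_measure \<rho>) N) {- real n<..real n} \<noteq> \<infinity>" for n :: nat
    using \<open>mono \<rho>\<close>
    by (simp add: emeasure_add_measure emeasure_stieltjes_measure N.emeasure_eq_measure)
  show "sets (add_measure (stieltjes_measure \<rho>) N) = sigma_sets UNIV (range (\<lambda>(a, b). {a<..b}))"
    "sets (add_measure P free_measure) = sigma_sets UNIV (range (\<lambda>(a, b). {a<..b}))"
    by (simp_all add: borel_sigma_sets_Ioc)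
qed simp

text \<open>Integrability for the free measure is obtained without estimating any transform:
  \<open>j\<close> is integrable for \<open>\<rho>\<close> and for \<open>N\<close>, hence for their
  sum, which is also \<open>P\<close> plus the free measure.\<close>

lemma
  fixes j :: "real \<Rightarrow> real"
  assumes "mono \<rho>" and W: "stieltjes_signed_measure (omega_function \<rho>) W"
    and jordan: "jordan_decomposition W P N" and "finite_measure P" "finite_measure N"
    and j: "j \<in> borel_measurable borel"
    and int: "integrable (stieltjes_measure \<rho>) j" "integrable P j" "integrable N j"
  shows integrable_free_part: "integrable lborel (\<lambda>s. indicator {0<..} s * j (s\<^sup>2))"
    and integral_stieltjes_measure: "integral\<^sup>L (stieltjes_measure \<rho>) j
      = integral\<^sup>L P j - integral\<^sup>L N j + 2 / pi * (\<integral>s. indicator {0<..} s * j (s\<^sup>2) \<partial>lborel)"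
proof -
  have sets: "sets P = sets borel" "sets N = sets borel"
    using jordan by (auto simp: jordan_decomposition_def)
  note eq = add_measure_stieltjes_eq[OF assms(1-5)]
  have "integrable (add_measure (stieltjes_measure \<rho>) N) j"
    using int sets by (simp add: integrable_add_measure)
  then have free: "integrable free_measure j"
    using sets by (simp add: eq integrable_add_measure)
  then show "integrable lborel (\<lambda>s. indicator {0<..} s * j (s\<^sup>2))"
    using j by (simp add: integrable_free_measure)
  have "integral\<^sup>L (stieltjes_measure \<rho>) j + integral\<^sup>L N j = integral\<^sup>L P j + integral\<^sup>L free_measure j"
    using integral_add_measure[of "stieltjes_measure \<rho>" N j] integral_add_measure[of P free_measure j]
      int free sets by (simp add: eq)
  then show "integral\<^sup>L (stieltjes_measure \<rho>) j
      = integral\<^sup>L P j - integral\<^sup>L N j + 2 / pi * (\<integral>s. indicator {0<..} s * j (s\<^sup>2) \<partial>lborel)"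
    by (simp add: integral_free_measure[OF j])
qed

section \<open>Averages and a Volterra inequality\<close>

text \<open>Left undivided by \<open>d\<close>, the estimate covers \<open>d = 0\<close>, and with
  \<open>l = 0\<close> it doubles as a plain size bound for an integral over a box.\<close>

lemma average_bound:
  fixes F :: "real \<Rightarrow> real"
  assumes [measurable]: "F \<in> borel_measurable borel" and "d \<ge> 0"
    and bound: "\<And>s. s \<in> {a..a + d} \<Longrightarrow> \<bar>F s - l\<bar> \<le> e"
  shows "\<bar>(\<integral>s. indicator {a..a + d} s * F s \<partial>lborel) - d * l\<bar> \<le> d * e"
proof -
  note int = integrable_indicator_Icc_mult
  have const: "(\<integral>s. indicator {a..a + d} s * c \<partial>lborel) = d * c" for c :: real
    using \<open>d \<ge> 0\<close> by simp
  have le: "\<bar>indicator {a..a + d} s * (F s - l)\<bar> \<le> indicator {a..a + d} s * e" for s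
    using bound[of s] by (auto simp: indicator_def)
  have diff: "integrable lborel (\<lambda>s. indicator {a..a + d} s * (F s - l))"
    by (rule Bochner_Integration.integrable_bound[OF int[of a "a + d" e]])
       (use le in \<open>auto intro!: AE_I2 order_trans[OF le] simp del: abs_mult\<close>)
  have "(\<integral>s. indicator {a..a + d} s * F s \<partial>lborel)
      = (\<integral>s. indicator {a..a + d} s * (F s - l) + indicator {a..a + d} s * l \<partial>lborel)"
    by (simp add: algebra_simps)
  also have "\<dots> = (\<integral>s. indicator {a..a + d} s * (F s - l) \<partial>lborel) + d * l"
    by (subst Bochner_Integration.integral_add[OF diff int]) (simp only: const)
  finally have "\<bar>(\<integral>s. indicator {a..a + d} s * F s \<partial>lborel) - d * l\<bar>
      = \<bar>\<integral>s. indicator {a..a + d} s * (F s - l) \<partial>lborel\<bar>"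
    by simp
  also have "\<dots> \<le> (\<integral>s. \<bar>indicator {a..a + d} s * (F s - l)\<bar> \<partial>lborel)"
    by (rule integral_abs_bound)
  also have "\<dots> \<le> (\<integral>s. indicator {a..a + d} s * e \<partial>lborel)"
    by (rule integral_mono[OF integrable_abs[OF diff] int le])
  finally show ?thesis
    by (simp only: const)
qed

text \<open>\<open>F\<close> may depend on \<open>n\<close> because in the double average of the
  kernel the integrand is itself an average over a box of length \<open>d n\<close>.\<close>

lemma average_tendsto:
  fixes F :: "nat \<Rightarrow> real \<Rightarrow> real"
  assumes F: "\<And>n. F n \<in> borel_measurable borel" and d: "\<And>n. d n > 0"
    and lim: "\<And>e. e > 0 \<Longrightarrow> eventually (\<lambda>n. \<forall>s\<in>{a..a + d n}. \<bar>F n s - l\<bar> \<le> e) sequentially"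
  shows "(\<lambda>n. (\<integral>s. indicator {a..a + d n} s * F n s \<partial>lborel) / d n) \<longlonglongrightarrow> l"
proof (rule LIMSEQ_I)
  fix r :: real
  assume "r > 0"
  then have "eventually (\<lambda>n. \<forall>s\<in>{a..a + d n}. \<bar>F n s - l\<bar> \<le> r / 2) sequentially"
    by (intro lim) simp
  then obtain n0 where n0: "\<And>n s. n \<ge> n0 \<Longrightarrow> s \<in> {a..a + d n} \<Longrightarrow> \<bar>F n s - l\<bar> \<le> r / 2"
    unfolding eventually_sequentially by blast
  have "norm ((\<integral>s. indicator {a..a + d n} s * F n s \<partial>lborel) / d n - l) < r" if "n \<ge> n0" for n
  proof -
    let ?I = "\<integral>s. indicator {a..a + d n} s * F n s \<partial>lborel"
    have "\<bar>?I - d n * l\<bar> \<le> d n * (r / 2)"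
      using n0[OF that] d[of n] by (intro average_bound[OF F]) auto
    also have "?I - d n * l = d n * (?I / d n - l)"
      using d[of n] by (simp add: field_simps)
    finally have "\<bar>?I / d n - l\<bar> \<le> r / 2"
      using d[of n] by (simp add: abs_mult)
    then show ?thesis
      using \<open>r > 0\<close> by simp
  qed
  then show "\<exists>n0. \<forall>n\<ge>n0. norm ((\<integral>s. indicator {a..a + d n} s * F n s \<partial>lborel) / d n - l) < r"
    by blast
qed

text \<open>Picard iteration: inserting a bound of degree \<open>n\<close> into the integral
  inequality and integrating gives the next one, of degree \<open>n + 1\<close>. The bounds are
  \<open>B\<close> times the terms of the exponential series at \<open>C * c\<close>, which tend to
  0.\<close>

lemma volterra_inequality_zero:
  fixes u :: "real \<Rightarrow> real"
  assumes [measurable]: "u \<in> borel_measurable borel" and "C \<ge> 0"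
    and bound: "\<And>t. 0 \<le> t \<Longrightarrow> t < a \<Longrightarrow> \<bar>u t\<bar> \<le> B"
    and ineq: "\<And>c. 0 \<le> c \<Longrightarrow> c < a \<Longrightarrow> \<bar>u c\<bar> \<le> C * (\<integral>t. indicator {0..c} t * \<bar>u t\<bar> \<partial>lborel)"
    and c: "0 \<le> c" "c < a"
  shows "u c = 0"
proof -
  have iterate: "\<bar>u c\<bar> \<le> B * ((C * c) ^ n / fact n)" if "0 \<le> c" "c < a" for n c
    using that
  proof (induction n arbitrary: c)
    case 0
    then show ?case using bound by simp
  next
    case (Suc n)
    let ?p = "\<lambda>t. B * ((C * t) ^ n / fact n)"
    have deriv: "((\<lambda>t. B * C ^ n * t ^ Suc n / fact (Suc n)) has_real_derivative ?p t) (at t)" for t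
    proof -
      have "((\<lambda>t. B * C ^ n / fact (Suc n) * t ^ Suc n) has_real_derivative
          B * C ^ n / fact (Suc n) * (real (Suc n) * t ^ n)) (at t)"
        using DERIV_pow[of "Suc n" t] by (intro DERIV_cmult) simp
      moreover have "B * C ^ n / fact (Suc n) * (real (Suc n) * t ^ n) = ?p t"
        by (simp only: fact_Suc of_nat_mult power_mult_distrib) (simp del: of_nat_Suc)
      ultimately show ?thesis
        by (simp only: times_divide_eq_left)
    qed
    have p: "has_bochner_integral lborel (\<lambda>t. ?p t * indicator {0..c} t)
        (B * C ^ n * c ^ Suc n / fact (Suc n) - B * C ^ n * 0 ^ Suc n / fact (Suc n))"
      using Suc.prems deriv by (intro has_bochner_integral_FTC_Icc_real) (auto intro!: continuous_intros)
    have le: "indicator {0..c} t * \<bar>u t\<bar> \<le> ?p t * indicator {0..c} t" for t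
      using Suc.IH[of t] Suc.prems by (auto simp: indicator_def)
    have "(\<integral>t. indicator {0..c} t * \<bar>u t\<bar> \<partial>lborel) \<le> (\<integral>t. ?p t * indicator {0..c} t \<partial>lborel)"
    proof (rule integral_mono[OF _ _ le])
      show p_int: "integrable lborel (\<lambda>t. ?p t * indicator {0..c} t)"
        using p by (rule integrable.intros)
      show "integrable lborel (\<lambda>t. indicator {0..c} t * \<bar>u t\<bar>)"
      proof (rule Bochner_Integration.integrable_bound[OF p_int _ AE_I2])
        fix t
        have "norm (indicator {0..c} t * \<bar>u t\<bar>) = indicator {0..c} t * \<bar>u t\<bar>"
          by (simp add: abs_mult)
        then show "norm (indicator {0..c} t * \<bar>u t\<bar>) \<le> norm (?p t * indicator {0..c} t)"
          using le[of t] abs_ge_self[of "?p t * indicator {0..c} t"] by (simp only: real_norm_def)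
      qed measurable
    qed
    also have "\<dots> = B * C ^ n * c ^ Suc n / fact (Suc n)"
      using has_bochner_integral_integral_eq[OF p] by simp
    finally have "C * (\<integral>t. indicator {0..c} t * \<bar>u t\<bar> \<partial>lborel) \<le> C * (B * C ^ n * c ^ Suc n / fact (Suc n))"
      using \<open>C \<ge> 0\<close> by (rule mult_left_mono)
    with ineq[OF Suc.prems] show ?case
      by (simp add: power_mult_distrib mult_ac)
  qed
  have "(\<lambda>n. B * ((C * c) ^ n / fact n)) \<longlonglongrightarrow> B * 0"
    using summable_LIMSEQ_zero[OF summable_exp[of "C * c"]]
    by (intro tendsto_intros) (simp add: field_simps)
  then have "\<bar>u c\<bar> \<le> 0"
    using iterate[OF c] by (intro LIMSEQ_le_const[of _ 0]) auto
  then show ?thesis by simp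
qed

section \<open>The transformation operator\<close>

lemma borel_measurable_cos_sqrt[measurable (raw)]:
  assumes [measurable]: "f \<in> borel_measurable M" "g \<in> borel_measurable M"
  shows "(\<lambda>w. cos_sqrt (f w) (g w)) \<in> borel_measurable M"
  unfolding cos_sqrt_def cosh_def by measurable

lemma isCont_cos_sqrt: "isCont (cos_sqrt \<mu>) t"
  unfolding cos_sqrt_def by (cases "\<mu> \<ge> 0") (auto intro!: continuous_intros)

lemma cos_sqrt_power2: "s > 0 \<Longrightarrow> cos_sqrt (s\<^sup>2) t = cos (s * t)"
  by (simp add: cos_sqrt_def)

text \<open>A common majorant of the cosines for all \<open>t\<close> in \<open>{0..X}\<close>: 1
  bounds them if \<open>\<mu> \<ge> 0\<close>, and the increasing \<open>cosh\<close> is largest at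
  \<open>X\<close> if \<open>\<mu> < 0\<close>. Being built from \<open>cos_sqrt \<mu> X\<close>,
  its square is controlled by the integrand of \<open>f X X\<close>.\<close>

definition cos_bound :: "real \<Rightarrow> real \<Rightarrow> real" where
  "cos_bound X \<mu> = max 1 \<bar>cos_sqrt \<mu> X\<bar>"

lemma cos_bound_ge_1: "1 \<le> cos_bound X \<mu>"
  by (simp add: cos_bound_def)

lemma borel_measurable_cos_bound[measurable]: "cos_bound X \<in> borel_measurable borel"
  unfolding cos_bound_def by measurable

lemma abs_cos_sqrt_le:
  assumes "0 \<le> t" "t \<le> X"
  shows "\<bar>cos_sqrt \<mu> t\<bar> \<le> cos_bound X \<mu>"
proof (cases "\<mu> \<ge> 0")
  case True
  then show ?thesis
    by (auto simp: cos_sqrt_def cos_bound_def intro: order_trans[OF abs_cos_le_one])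
next
  case False
  have "cosh (sqrt \<bar>\<mu>\<bar> * t) \<le> cosh (sqrt \<bar>\<mu>\<bar> * X)"
    using assms by (intro cosh_real_nonneg_le_iff[THEN iffD2] mult_left_mono mult_nonneg_nonneg) auto
  then show ?thesis
    using False by (simp add: cos_sqrt_def cos_bound_def)
qed

lemma cos_bound_power2: "(cos_bound X \<mu>)\<^sup>2 \<le> 1 + cos_sqrt \<mu> X * cos_sqrt \<mu> X"
  by (auto simp: cos_bound_def max_def power2_eq_square)

locale volterra_kernel =
  fixes K :: "real \<Rightarrow> real \<Rightarrow> real"
  assumes cont: "continuous_on {(x, t). 0 \<le> t \<and> t \<le> x} (\<lambda>(x, t). K x t)"
begin

text \<open>Extension of the kernel by zero, so that integrals run over the whole line and
  exchanging their order needs no bookkeeping of limits. The price is possible jumps along the two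
  edges of the triangle.\<close>

definition L :: "real \<Rightarrow> real \<Rightarrow> real" where
  "L x t = (if 0 \<le> t \<and> t \<le> x then K x t else 0)"

text \<open>The integral representation taken as a definition on the whole plane. The
  \<open>\<phi>\<close> of the theorem agrees with it for \<open>x \<ge> 0\<close> but is
  unconstrained at negative \<open>x\<close>, whereas this function is jointly measurable.\<close>

definition phi :: "real \<Rightarrow> real \<Rightarrow> real" where
  "phi x \<mu> = cos_sqrt \<mu> x + (\<integral>t. L x t * cos_sqrt \<mu> t \<partial>lborel)"

lemma closed_triangle: "closed {(x, t). 0 \<le> t \<and> t \<le> (x::real)}"
  unfolding case_prod_beta by (intro closed_Collect_conj closed_Collect_le continuous_intros)

lemma borel_measurable_L[measurable (raw)]:
  assumes [measurable]: "f \<in> borel_measurable M" "g \<in> borel_measurable M"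
  shows "(\<lambda>w. L (f w) (g w)) \<in> borel_measurable M"
proof -
  let ?T = "{(x, t). 0 \<le> t \<and> t \<le> (x::real)}"
  have "(\<lambda>p. indicator ?T p *\<^sub>R (case p of (x, t) \<Rightarrow> K x t)) \<in> borel_measurable borel"
    using closed_triangle cont by (intro borel_measurable_continuous_on_indicator) auto
  also have "(\<lambda>p. indicator ?T p *\<^sub>R (case p of (x, t) \<Rightarrow> K x t)) = (\<lambda>p. L (fst p) (snd p))"
    by (auto simp: L_def indicator_def)
  finally have "(\<lambda>p. L (fst p) (snd p)) \<in> borel_measurable (borel \<Otimes>\<^sub>M borel)"
    by (simp add: borel_prod)
  from measurable_compose[OF measurable_Pair[OF assms] this] show ?thesis
    by simp
qed

text \<open>The triangle cut off at \<open>X\<close> is compact, and outside it \<open>L\<close>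
  vanishes.\<close>

lemma L_bound:
  obtains C where "C \<ge> 0" "\<And>x t. x \<le> X \<Longrightarrow> \<bar>L x t\<bar> \<le> C"
proof -
  let ?T = "{(x, t). 0 \<le> t \<and> t \<le> (x::real)} \<inter> ({0..X} \<times> {0..X})"
  have "compact ?T"
    by (intro closed_Int_compact closed_triangle compact_Times compact_Icc)
  then have "compact ((\<lambda>(x, t). K x t) ` ?T)"
    by (rule compact_continuous_image[rotated]) (rule continuous_on_subset[OF cont], auto)
  then obtain C where C: "\<forall>z\<in>(\<lambda>(x, t). K x t) ` ?T. norm z \<le> C"
    using compact_imp_bounded bounded_iff by blast
  have "\<bar>L x t\<bar> \<le> max C 0" if "x \<le> X" for x t
  proof (cases "0 \<le> t \<and> t \<le> x")
    case True
    then have "(x, t) \<in> ?T" using that by auto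
    then have "norm (K x t) \<le> C" using C by blast
    then show ?thesis using True by (simp add: L_def)
  qed (auto simp: L_def)
  then show thesis
    by (intro that[of "max C 0"]) auto
qed

lemma L_eq_0: "t \<notin> {0..x} \<Longrightarrow> L x t = 0"
  by (auto simp: L_def)

lemma isCont_L_fst:
  assumes "t \<noteq> x"
  shows "isCont (\<lambda>x. L x t) x"
proof (cases "0 \<le> t \<and> t < x")
  case True
  have "continuous_on {t<..} (\<lambda>x. (\<lambda>(x, t). K x t) (x, t))"
    by (rule continuous_on_compose2[OF cont]) (use True in \<open>auto intro!: continuous_intros\<close>)
  then have "isCont (\<lambda>x. K x t) x"
    using True by (simp add: continuous_on_eq_continuous_at)
  moreover have "eventually (\<lambda>x. L x t = K x t) (nhds x)"
    by (rule eventually_mono[OF eventually_nhds_in_open[of "{t<..}"]]) (use True in \<open>auto simp: L_def\<close>)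
  ultimately show ?thesis
    by (simp add: isCont_cong)
next
  case False
  have "eventually (\<lambda>x. L x t = 0) (nhds x)"
  proof (cases "t < 0")
    case True
    then show ?thesis by (simp add: L_def)
  next
    case F: False
    show ?thesis
      by (rule eventually_mono[OF eventually_nhds_in_open[of "{..<t}"]])
         (use False F assms in \<open>auto simp: L_def\<close>)
  qed
  then show ?thesis
    by (simp add: isCont_cong)
qed

text \<open>Varying \<open>t\<close> can cross both edges of the triangle, so 0 is excluded as well;
  varying \<open>x\<close> with \<open>t\<close> fixed crosses only the diagonal.\<close>

lemma isCont_L_snd:
  assumes "t \<noteq> x" "t \<noteq> 0"
  shows "isCont (L x) t"
proof (cases "0 < t \<and> t < x")
  case True
  have "continuous_on {0<..<x} (\<lambda>t. (\<lambda>(x, t). K x t) (x, t))"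
    by (rule continuous_on_compose2[OF cont]) (auto intro!: continuous_intros)
  then have "isCont (K x) t"
    using True by (simp add: continuous_on_eq_continuous_at)
  moreover have "eventually (\<lambda>t. L x t = K x t) (nhds t)"
    by (rule eventually_mono[OF eventually_nhds_in_open[of "{0<..<x}"]]) (use True in \<open>auto simp: L_def\<close>)
  ultimately show ?thesis
    by (simp add: isCont_cong)
next
  case False
  have "eventually (\<lambda>t. L x t = 0) (nhds t)"
    by (rule eventually_mono[OF eventually_nhds_in_open[of "- {0..x}"]])
       (use False assms in \<open>auto simp: L_def\<close>)
  then show ?thesis
    by (simp add: isCont_cong)
qed

lemma borel_measurable_phi[measurable (raw)]:
  assumes [measurable]: "f \<in> borel_measurable M" "g \<in> borel_measurable M"
  shows "(\<lambda>w. phi (f w) (g w)) \<in> borel_measurable M"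
  unfolding phi_def by measurable

lemma integrable_L_cos: "integrable lborel (\<lambda>t. L x t * cos_sqrt \<mu> t)"
proof -
  obtain C where C: "C \<ge> 0" "\<And>x' t. x' \<le> x \<Longrightarrow> \<bar>L x' t\<bar> \<le> C" using L_bound by metis
  show ?thesis
  proof (rule integrable_bounded_support[where a = 0 and b = x])
    show "\<bar>L x t * cos_sqrt \<mu> t\<bar> \<le> C * cos_bound x \<mu>" for t
    proof (cases "t \<in> {0..x}")
      case True
      then show ?thesis
        using C abs_cos_sqrt_le[of t x \<mu>] by (auto simp: abs_mult intro!: mult_mono)
    next
      case False
      then show ?thesis
        using C(1) cos_bound_ge_1[of x \<mu>] by (simp add: L_eq_0)
    qed
  qed (auto simp: L_eq_0)
qed

text \<open>The constant is independent of \<open>\<mu>\<close>: all growth in \<open>\<mu>\<close>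
  is carried by \<open>cos_bound X\<close>, which makes the bound usable as a majorant for integrals
  over \<open>\<mu>\<close>.\<close>

lemma phi_bound:
  obtains C where "C \<ge> 0" "\<And>x \<mu>. 0 \<le> x \<Longrightarrow> x \<le> X \<Longrightarrow> \<bar>phi x \<mu>\<bar> \<le> C * cos_bound X \<mu>"
proof -
  obtain C where C: "C \<ge> 0" "\<And>x' t. x' \<le> X \<Longrightarrow> \<bar>L x' t\<bar> \<le> C" using L_bound by metis
  have "\<bar>phi x \<mu>\<bar> \<le> (1 + X * C) * cos_bound X \<mu>" if x: "0 \<le> x" "x \<le> X" for x \<mu>
  proof -
    have le: "\<bar>L x t * cos_sqrt \<mu> t\<bar> \<le> indicator {0..X} t * (C * cos_bound X \<mu>)" for t
      using C x L_eq_0[of t x] abs_cos_sqrt_le[of t X \<mu>]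
      by (cases "t \<in> {0..x}") (auto simp: abs_mult indicator_def intro!: mult_mono)
    have int: "integrable lborel (\<lambda>t. indicator {0..X} t * (C * cos_bound X \<mu>))"
      by (rule integrable_indicator_Icc_mult)
    have "\<bar>\<integral>t. L x t * cos_sqrt \<mu> t \<partial>lborel\<bar> \<le> (\<integral>t. \<bar>L x t * cos_sqrt \<mu> t\<bar> \<partial>lborel)"
      by (rule integral_abs_bound)
    also have "\<dots> \<le> (\<integral>t. indicator {0..X} t * (C * cos_bound X \<mu>) \<partial>lborel)"
      by (rule integral_mono[OF integrable_abs[OF integrable_L_cos] int le])
    also have "\<dots> = X * C * cos_bound X \<mu>"
      using x by simp
    finally have "\<bar>phi x \<mu>\<bar> \<le> cos_bound X \<mu> + X * C * cos_bound X \<mu>"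
      unfolding phi_def using abs_cos_sqrt_le[OF x, of \<mu>] by linarith
    then show ?thesis
      by (simp add: algebra_simps)
  qed
  then show thesis
    using C(1) that[of "1 + X * C"] that[of 0] by (cases "X \<ge> 0") force+
qed

text \<open>The jump of the kernel on the diagonal affects only \<open>t = x\<close>, a null set for
  the integral over \<open>t\<close>.\<close>

lemma isCont_phi: "isCont (\<lambda>x. phi x \<mu>) x"
  unfolding continuous_at_sequentially
proof (intro allI impI)
  fix X :: "nat \<Rightarrow> real"
  assume X: "X \<longlonglongrightarrow> x"
  then obtain b where b: "\<And>n. X n \<le> b"
    using convergent_imp_Bseq[OF convergentI[OF X]] by (auto simp: Bseq_def dest: abs_le_D1)
  obtain C where C: "C \<ge> 0" "\<And>x' t. x' \<le> b \<Longrightarrow> \<bar>L x' t\<bar> \<le> C" using L_bound by metis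
  have "(\<lambda>n. \<integral>t. L (X n) t * cos_sqrt \<mu> t \<partial>lborel) \<longlonglongrightarrow> (\<integral>t. L x t * cos_sqrt \<mu> t \<partial>lborel)"
  proof (rule integral_dominated_convergence)
    show "integrable lborel (\<lambda>t. indicator {0..b} t * (C * cos_bound b \<mu>))"
      by (rule integrable_indicator_Icc_mult)
    show "AE t in lborel. (\<lambda>n. L (X n) t * cos_sqrt \<mu> t) \<longlonglongrightarrow> L x t * cos_sqrt \<mu> t"
      using AE_lborel_singleton[of x]
      by eventually_elim (intro tendsto_mult_right isCont_tendsto_compose[OF isCont_L_fst X], auto)
    show "AE t in lborel. norm (L (X n) t * cos_sqrt \<mu> t) \<le> indicator {0..b} t * (C * cos_bound b \<mu>)" for n
    proof (rule AE_I2)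
      fix t
      show "norm (L (X n) t * cos_sqrt \<mu> t) \<le> indicator {0..b} t * (C * cos_bound b \<mu>)"
        using C(2)[OF b[of n], of t] C(1) b[of n] L_eq_0[of t "X n"] abs_cos_sqrt_le[of t b \<mu>]
        by (cases "t \<in> {0..X n}") (auto simp: abs_mult indicator_def intro!: mult_mono)
    qed
  qed auto
  then show "((\<lambda>x. phi x \<mu>) \<circ> X) \<longlonglongrightarrow> phi x \<mu>"
    unfolding phi_def o_def by (intro tendsto_add isCont_tendsto_compose[OF isCont_cos_sqrt X])
qed

section \<open>Boxes and the transposed operator\<close>

definition k :: "real \<Rightarrow> real \<Rightarrow> real \<Rightarrow> real" where
  "k a b t = (\<integral>s. indicator {a..b} s * L s t \<partial>lborel)"

lemma borel_measurable_k[measurable]: "k a b \<in> borel_measurable borel"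
  unfolding k_def by measurable

lemma k_eq_0: "t \<notin> {0..b} \<Longrightarrow> k a b t = 0"
  unfolding k_def by (rule integral_eq_zero_AE) (auto simp: L_eq_0 indicator_def)

lemma abs_k_le:
  assumes "a \<le> b" and C: "\<And>x t. x \<le> b \<Longrightarrow> \<bar>L x t\<bar> \<le> C"
  shows "\<bar>k a b t\<bar> \<le> (b - a) * C"
  using average_bound[of "\<lambda>s. L s t" "b - a" a 0 C] assms by (simp add: k_def)

text \<open>Averaging over the first argument removes the diagonal jump: for given \<open>t\<close>
  it occurs only at \<open>s = t\<close>. The jump at the edge \<open>t = 0\<close> is common to
  many \<open>s\<close> and can survive.\<close>

lemma isCont_k:
  assumes "t \<noteq> 0"
  shows "isCont (k a b) t"
  unfolding continuous_at_sequentially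
proof (intro allI impI)
  fix X :: "nat \<Rightarrow> real"
  assume X: "X \<longlonglongrightarrow> t"
  obtain C where C: "C \<ge> 0" "\<And>x' t. x' \<le> b \<Longrightarrow> \<bar>L x' t\<bar> \<le> C" using L_bound by metis
  show "(k a b \<circ> X) \<longlonglongrightarrow> k a b t"
    unfolding k_def o_def
  proof (rule integral_dominated_convergence)
    show "integrable lborel (\<lambda>s. indicator {a..b} s * C)"
      by (rule integrable_indicator_Icc_mult)
    show "AE s in lborel. (\<lambda>n. indicator {a..b} s * L s (X n)) \<longlonglongrightarrow> indicator {a..b} s * L s t"
      using AE_lborel_singleton[of t]
      by eventually_elim (intro tendsto_mult_left isCont_tendsto_compose[OF isCont_L_snd X], use assms in auto)
    show "AE s in lborel. norm (indicator {a..b} s * L s (X n)) \<le> indicator {a..b} s * C" for n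
      by (rule AE_I2) (use C in \<open>auto simp: indicator_def\<close>)
  qed auto
qed

text \<open>The transpose of the transformation operator, applied to the indicator of \<open>{a..b}\<close>.\<close>

definition T :: "real \<Rightarrow> real \<Rightarrow> real \<Rightarrow> real" where
  "T a b t = indicator {a..b} t + k a b t"

lemma borel_measurable_T[measurable]: "T a b \<in> borel_measurable borel"
  unfolding T_def by measurable

lemma T_eq_0: "0 \<le> a \<Longrightarrow> t \<notin> {0..b} \<Longrightarrow> T a b t = 0"
  by (simp add: T_def k_eq_0 indicator_def)

text \<open>The finite exceptional set plays the role of \<open>S\<close> in
  \<open>cosine_transform_parseval\<close>.\<close>

lemma isCont_T:
  assumes "t \<notin> {0, a, b}"
  shows "isCont (T a b) t"
proof -
  consider "t < a" | "a < t" "t < b" | "b < t"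
    using assms by fastforce
  then have "eventually (\<lambda>x. indicator {a..b} x = (indicator {a..b} t :: real)) (nhds t)"
  proof cases
    case 1
    then show ?thesis
      by (intro eventually_mono[OF eventually_nhds_in_open[of "{..<a}"]]) (auto simp: indicator_def)
  next
    case 2
    then show ?thesis
      by (intro eventually_mono[OF eventually_nhds_in_open[of "{a<..<b}"]]) (auto simp: indicator_def)
  next
    case 3
    then show ?thesis
      by (intro eventually_mono[OF eventually_nhds_in_open[of "{b<..}"]]) (auto simp: indicator_def)
  qed
  then have "isCont (indicator {a..b} :: real \<Rightarrow> real) t"
    by (subst isCont_cong[where g = "\<lambda>_. indicator {a..b} t"]) auto
  then show ?thesis
    unfolding T_def using assms by (intro continuous_intros isCont_k) auto
qed

text \<open>The generalized Fourier transform, with kernel \<open>phi\<close>, of the indicator of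
  \<open>{a..b}\<close>.\<close>

definition Phi :: "real \<Rightarrow> real \<Rightarrow> real \<Rightarrow> real" where
  "Phi a b \<mu> = (\<integral>s. indicator {a..b} s * phi s \<mu> \<partial>lborel)"

lemma borel_measurable_Phi[measurable]: "Phi a b \<in> borel_measurable borel"
  unfolding Phi_def by measurable

text \<open>Fubini moves the transformation operator from the cosine to the indicator. At
  \<open>\<mu> = s\<^sup>2\<close> this turns a transform with kernel \<open>phi\<close> into an
  ordinary cosine transform.\<close>

lemma Phi_eq:
  assumes "0 \<le> a" "a \<le> b"
  shows "Phi a b \<mu> = (\<integral>t. T a b t * cos_sqrt \<mu> t \<partial>lborel)"
proof -
  obtain C where C: "C \<ge> 0" "\<And>x' t. x' \<le> b \<Longrightarrow> \<bar>L x' t\<bar> \<le> C" using L_bound by metis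
  have le: "\<bar>indicator {a..b} s * (L s t * cos_sqrt \<mu> t)\<bar>
      \<le> (indicator {a..b} s * C) * (indicator {0..b} t * cos_bound b \<mu>)" for s t
    using C abs_cos_sqrt_le[of t b \<mu>] L_eq_0[of t s]
    by (cases "t \<in> {0..s}"; cases "s \<in> {a..b}") (auto simp: abs_mult indicator_def intro!: mult_mono)
  note int = integrable_indicator_Icc_mult
  have cos_int: "integrable lborel (\<lambda>t. indicator {a..b} t * cos_sqrt \<mu> t)"
    by (rule Bochner_Integration.integrable_bound[OF int[of a b "cos_bound b \<mu>"]])
       (use assms abs_cos_sqrt_le[of _ b \<mu>] cos_bound_ge_1[of b \<mu>] in \<open>auto simp: indicator_def intro!: AE_I2\<close>)
  have fub: "(\<integral>s. (\<integral>t. indicator {a..b} s * (L s t * cos_sqrt \<mu> t) \<partial>lborel) \<partial>lborel)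
      = (\<integral>t. (\<integral>s. indicator {a..b} s * (L s t * cos_sqrt \<mu> t) \<partial>lborel) \<partial>lborel)"
    "integrable lborel (\<lambda>s. \<integral>t. indicator {a..b} s * (L s t * cos_sqrt \<mu> t) \<partial>lborel)"
    by (rule Fubini_product_bound[symmetric, OF _ _ _ int[of a b C] int[of 0 b "cos_bound b \<mu>"] le]
          integrable_product_bound[OF _ _ _ int[of a b C] int[of 0 b "cos_bound b \<mu>"] le];
        auto intro: lborel.sigma_finite_measure_axioms)+
  have kcos: "(\<integral>s. indicator {a..b} s * (L s t * cos_sqrt \<mu> t) \<partial>lborel) = k a b t * cos_sqrt \<mu> t" for t
    unfolding k_def by (simp only: integral_mult_left_zero mult.assoc[symmetric])
  have kcos_int: "integrable lborel (\<lambda>t. k a b t * cos_sqrt \<mu> t)"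
  proof (rule integrable_bounded_support[where a = 0 and b = b])
    show "\<bar>k a b t * cos_sqrt \<mu> t\<bar> \<le> ((b - a) * C) * cos_bound b \<mu>" for t
      using abs_k_le[OF assms(2) C(2), of t] abs_cos_sqrt_le[of t b \<mu>] k_eq_0[of t b a] C(1) assms
        cos_bound_ge_1[of b \<mu>]
      by (cases "t \<in> {0..b}") (auto simp: abs_mult intro!: mult_mono)
  qed (auto simp: k_eq_0)
  have "Phi a b \<mu> = (\<integral>s. indicator {a..b} s * cos_sqrt \<mu> s
      + (\<integral>t. indicator {a..b} s * (L s t * cos_sqrt \<mu> t) \<partial>lborel) \<partial>lborel)"
    unfolding Phi_def phi_def by (simp add: distrib_left)
  also have "\<dots> = (\<integral>s. indicator {a..b} s * cos_sqrt \<mu> s \<partial>lborel) + (\<integral>t. k a b t * cos_sqrt \<mu> t \<partial>lborel)"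
    by (simp only: Bochner_Integration.integral_add[OF cos_int fub(2)] fub(1) kcos)
  also have "\<dots> = (\<integral>t. T a b t * cos_sqrt \<mu> t \<partial>lborel)"
    unfolding T_def distrib_right by (simp only: Bochner_Integration.integral_add[OF cos_int kcos_int])
  finally show ?thesis .
qed

lemma Phi_power2:
  assumes "0 \<le> a" "a \<le> b" "s > 0"
  shows "Phi a b (s\<^sup>2) = cosine_transform (T a b) s"
  using assms by (simp add: Phi_eq cosine_transform_def cos_sqrt_power2)

lemma abs_Phi_le:
  assumes "0 \<le> a" "a \<le> b" and C: "\<And>x. 0 \<le> x \<Longrightarrow> x \<le> X \<Longrightarrow> \<bar>phi x \<mu>\<bar> \<le> C * cos_bound X \<mu>" and "b \<le> X"
  shows "\<bar>Phi a b \<mu>\<bar> \<le> (b - a) * (C * cos_bound X \<mu>)"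
  using average_bound[of "\<lambda>s. phi s \<mu>" "b - a" a 0 "C * cos_bound X \<mu>"] assms by (simp add: Phi_def)

end

section \<open>Exponential moments\<close>

definition cos_moments :: "real measure \<Rightarrow> bool" where
  "cos_moments M \<longleftrightarrow> sets M = sets borel \<and>
     (\<forall>X\<ge>0. integrable M (\<lambda>\<mu>. cos_sqrt \<mu> X * cos_sqrt \<mu> X))"

lemma sets_cos_moments: "cos_moments M \<Longrightarrow> sets M = sets borel"
  by (simp add: cos_moments_def)

lemma finite_measure_cos_moments:
  assumes "cos_moments M"
  shows "finite_measure M"
proof (rule finite_measureI)
  have "cos_sqrt \<mu> 0 = 1" for \<mu>
    by (simp add: cos_sqrt_def)
  then have "integrable M (\<lambda>_. 1 :: real)"
    using assms by (auto simp: cos_moments_def dest!: spec[of _ 0])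
  then show "emeasure M (space M) \<noteq> \<infinity>"
    by (simp add: integrable_iff_bounded)
qed

lemma integrable_cos_bound:
  assumes M: "cos_moments M" and "X \<ge> 0"
  shows "integrable M (\<lambda>\<mu>. (cos_bound X \<mu>)\<^sup>2)"
proof -
  interpret finite_measure M by (rule finite_measure_cos_moments[OF M])
  note [measurable_cong] = sets_cos_moments[OF M]
  have "integrable M (\<lambda>\<mu>. 1 + cos_sqrt \<mu> X * cos_sqrt \<mu> X)"
    using assms by (auto simp: cos_moments_def)
  then show ?thesis
    by (rule Bochner_Integration.integrable_bound)
       (auto intro!: AE_I2 order_trans[OF cos_bound_power2])
qed

lemma integrable_le_cos_bound:
  assumes M: "cos_moments M" and "X \<ge> 0"
    and f: "f \<in> borel_measurable borel" and le: "\<And>\<mu>. \<bar>f \<mu>\<bar> \<le> c * (cos_bound X \<mu>)\<^sup>2"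
  shows "integrable M f"
proof -
  have "integrable M (\<lambda>\<mu>. c * (cos_bound X \<mu>)\<^sup>2)"
    using integrable_cos_bound[OF M \<open>X \<ge> 0\<close>] by simp
  then show ?thesis
  proof (rule Bochner_Integration.integrable_bound)
    show "f \<in> borel_measurable M"
      using f measurable_cong_sets[OF sets_cos_moments[OF M] refl] by blast
    show "AE \<mu> in M. norm (f \<mu>) \<le> norm (c * (cos_bound X \<mu>)\<^sup>2)"
      by (intro AE_I2) (metis abs_ge_self le order_trans real_norm_def)
  qed
qed

section \<open>The generalized Fourier transform of compactly supported functions\<close>

text \<open>Once \<open>n \<ge> A\<close> the truncated transforms no longer change, so convergence
  to \<open>E\<close> forces \<open>E\<close> to equal the transform almost everywhere, and
  Parseval's identity for \<open>E\<close> passes to it.\<close>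

lemma
  assumes spectral: "spectral_function \<phi> \<rho>"
    and g[measurable]: "g \<in> borel_measurable borel" and bound: "\<And>t. \<bar>g t\<bar> \<le> B"
    and supp: "\<And>t. t \<notin> {0..A} \<Longrightarrow> g t = 0"
    and G[measurable]: "(\<lambda>\<mu>. \<integral>x. g x * \<phi> x \<mu> \<partial>lborel) \<in> borel_measurable borel"
  shows integrable_spectral_transform:
      "integrable (stieltjes_measure \<rho>) (\<lambda>\<mu>. (\<integral>x. g x * \<phi> x \<mu> \<partial>lborel)\<^sup>2)"
    and integral_spectral_transform:
      "(\<integral>\<mu>. (\<integral>x. g x * \<phi> x \<mu> \<partial>lborel)\<^sup>2 \<partial>stieltjes_measure \<rho>) = (\<integral>x. (g x)\<^sup>2 \<partial>lborel)"
proof -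
  let ?R = "stieltjes_measure \<rho>"
  let ?G = "\<lambda>\<mu>. \<integral>x. g x * \<phi> x \<mu> \<partial>lborel"
  have "set_integrable lborel {0<..} (\<lambda>x. (g x)\<^sup>2)"
    unfolding set_integrable_def
  proof (rule integrable_bounded_support[where a = 0 and b = A and B = "B\<^sup>2"])
    show "\<bar>indicator {0<..} t *\<^sub>R (g t)\<^sup>2\<bar> \<le> B\<^sup>2" for t
      using power_mono[OF bound[of t], of 2] by (auto simp: indicator_def)
  qed (auto simp: supp)
  then obtain E where E[measurable]: "E \<in> borel_measurable borel"
    and E_int: "integrable ?R (\<lambda>\<mu>. (E \<mu>)\<^sup>2)"
    and lim: "(\<lambda>n::nat. \<integral>\<^sup>+\<mu>. ennreal (((LBINT x:{0..real n}. g x * \<phi> x \<mu>) - E \<mu>)\<^sup>2) \<partial>?R) \<longlonglongrightarrow> 0"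
    and E_eq: "(\<integral>\<mu>. (E \<mu>)\<^sup>2 \<partial>?R) = (LBINT x:{0<..}. (g x)\<^sup>2)"
    using spectral g unfolding spectral_function_def by blast
  obtain N :: nat where N: "A \<le> real N"
    using real_arch_simple by blast
  have "(LBINT x:{0..real (n + N)}. g x * \<phi> x \<mu>) = ?G \<mu>" for n \<mu>
    unfolding set_lebesgue_integral_def
  proof (rule Bochner_Integration.integral_cong)
    fix x
    show "indicator {0..real (n + N)} x *\<^sub>R (g x * \<phi> x \<mu>) = g x * \<phi> x \<mu>"
      using N supp[of x] by (cases "x \<in> {0..A}") (auto simp: indicator_def)
  qed simp
  with LIMSEQ_ignore_initial_segment[OF lim, of N]
  have "(\<integral>\<^sup>+\<mu>. ennreal ((?G \<mu> - E \<mu>)\<^sup>2) \<partial>?R) = 0"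
    by (simp add: LIMSEQ_const_iff)
  then have ae: "AE \<mu> in ?R. (E \<mu>)\<^sup>2 = (?G \<mu>)\<^sup>2"
    by (subst (asm) nn_integral_0_iff_AE) (auto elim!: eventually_mono simp: ennreal_eq_0_iff)
  show "integrable ?R (\<lambda>\<mu>. (?G \<mu>)\<^sup>2)"
    using E_int by (subst (asm) integrable_cong_AE[OF _ _ ae]) auto
  have "(\<integral>\<mu>. (?G \<mu>)\<^sup>2 \<partial>?R) = (LBINT x:{0<..}. (g x)\<^sup>2)"
    unfolding E_eq[symmetric] by (rule integral_cong_AE[OF _ _ ae, symmetric]) auto
  also have "\<dots> = (\<integral>x. (g x)\<^sup>2 \<partial>lborel)"
    unfolding set_lebesgue_integral_def
  proof (rule integral_cong_AE)
    show "AE x in lborel. indicator {0<..} x *\<^sub>R (g x)\<^sup>2 = (g x)\<^sup>2"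
      using AE_lborel_singleton[of 0]
      by eventually_elim (use supp in \<open>auto simp: indicator_def\<close>)
  qed auto
  finally show "(\<integral>\<mu>. (?G \<mu>)\<^sup>2 \<partial>?R) = (\<integral>x. (g x)\<^sup>2 \<partial>lborel)" .
qed

context volterra_kernel
begin

lemma integrable_indicator_phi: "0 \<le> a \<Longrightarrow> integrable lborel (\<lambda>s. indicator {a..b} s * phi s \<mu>)"
proof -
  assume "0 \<le> a"
  obtain C where C: "C \<ge> 0" "\<And>x \<mu>. 0 \<le> x \<Longrightarrow> x \<le> b \<Longrightarrow> \<bar>phi x \<mu>\<bar> \<le> C * cos_bound b \<mu>"
    using phi_bound by metis
  show ?thesis
  proof (rule integrable_bounded_support[where a = a and b = b])
    show "\<bar>indicator {a..b} s * phi s \<mu>\<bar> \<le> C * cos_bound b \<mu>" for s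
      using C \<open>0 \<le> a\<close> cos_bound_ge_1[of b \<mu>] by (auto simp: indicator_def)
  qed auto
qed

text \<open>Parseval's identity for \<open>indicator {a..b}\<close>, \<open>indicator {c..d}\<close> and their sum, polarized.\<close>

lemma
  assumes spectral: "spectral_function phi \<rho>" and order: "0 \<le> c" "c \<le> d" "d < a" "a \<le> b"
  shows integrable_Phi_mult: "integrable (stieltjes_measure \<rho>) (\<lambda>\<mu>. Phi a b \<mu> * Phi c d \<mu>)"
    and integral_Phi_mult: "(\<integral>\<mu>. Phi a b \<mu> * Phi c d \<mu> \<partial>stieltjes_measure \<rho>) = 0"
proof -
  let ?R = "stieltjes_measure \<rho>"
  let ?g = "\<lambda>x. indicator {a..b} x :: real" and ?h = "\<lambda>x. indicator {c..d} x :: real"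
  have Phi_add: "(\<integral>x. (?g x + ?h x) * phi x \<mu> \<partial>lborel) = Phi a b \<mu> + Phi c d \<mu>" for \<mu>
    unfolding Phi_def distrib_right
    using order by (intro Bochner_Integration.integral_add integrable_indicator_phi) auto
  have "integrable ?R (\<lambda>\<mu>. (\<integral>x. ?g x * phi x \<mu> \<partial>lborel)\<^sup>2)
    \<and> (\<integral>\<mu>. (\<integral>x. ?g x * phi x \<mu> \<partial>lborel)\<^sup>2 \<partial>?R) = (\<integral>x. (?g x)\<^sup>2 \<partial>lborel)"
    by (intro conjI integrable_spectral_transform[OF spectral, of _ 1 b]
        integral_spectral_transform[OF spectral, of _ 1 b]) (use order in \<open>auto simp: indicator_def\<close>)
  then have 1: "integrable ?R (\<lambda>\<mu>. (Phi a b \<mu>)\<^sup>2)" "(\<integral>\<mu>. (Phi a b \<mu>)\<^sup>2 \<partial>?R) = (\<integral>x. (?g x)\<^sup>2 \<partial>lborel)"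
    by (simp_all add: Phi_def)
  have "integrable ?R (\<lambda>\<mu>. (\<integral>x. ?h x * phi x \<mu> \<partial>lborel)\<^sup>2)
    \<and> (\<integral>\<mu>. (\<integral>x. ?h x * phi x \<mu> \<partial>lborel)\<^sup>2 \<partial>?R) = (\<integral>x. (?h x)\<^sup>2 \<partial>lborel)"
    by (intro conjI integrable_spectral_transform[OF spectral, of _ 1 b]
        integral_spectral_transform[OF spectral, of _ 1 b]) (use order in \<open>auto simp: indicator_def\<close>)
  then have 2: "integrable ?R (\<lambda>\<mu>. (Phi c d \<mu>)\<^sup>2)" "(\<integral>\<mu>. (Phi c d \<mu>)\<^sup>2 \<partial>?R) = (\<integral>x. (?h x)\<^sup>2 \<partial>lborel)"
    by (simp_all add: Phi_def)
  have "integrable ?R (\<lambda>\<mu>. (\<integral>x. (?g x + ?h x) * phi x \<mu> \<partial>lborel)\<^sup>2)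
    \<and> (\<integral>\<mu>. (\<integral>x. (?g x + ?h x) * phi x \<mu> \<partial>lborel)\<^sup>2 \<partial>?R) = (\<integral>x. (?g x + ?h x)\<^sup>2 \<partial>lborel)"
    by (intro conjI integrable_spectral_transform[OF spectral, of _ 2 b]
        integral_spectral_transform[OF spectral, of _ 2 b]) (use order in \<open>auto simp: indicator_def\<close>)
  then have 3: "integrable ?R (\<lambda>\<mu>. (Phi a b \<mu> + Phi c d \<mu>)\<^sup>2)"
    "(\<integral>\<mu>. (Phi a b \<mu> + Phi c d \<mu>)\<^sup>2 \<partial>?R) = (\<integral>x. (?g x + ?h x)\<^sup>2 \<partial>lborel)"
    by (simp_all add: Phi_add)
  have eq: "Phi a b \<mu> * Phi c d \<mu>
      = ((Phi a b \<mu> + Phi c d \<mu>)\<^sup>2 - (Phi a b \<mu>)\<^sup>2 - (Phi c d \<mu>)\<^sup>2) / 2" for \<mu>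
    by (simp add: power2_eq_square algebra_simps)
  show "integrable ?R (\<lambda>\<mu>. Phi a b \<mu> * Phi c d \<mu>)"
    unfolding eq using 1(1) 2(1) 3(1) by auto
  \<comment> \<open>No cross term: the boxes are disjoint because \<open>d < a\<close>.\<close>
  have "(?g x + ?h x)\<^sup>2 = (?g x)\<^sup>2 + (?h x)\<^sup>2" for x
    using order by (auto simp: indicator_def)
  then have "(\<integral>x. (?g x + ?h x)\<^sup>2 \<partial>lborel) = (\<integral>x. (?g x)\<^sup>2 + (?h x)\<^sup>2 \<partial>lborel)"
    by simp
  also have "\<dots> = (\<integral>x. (?g x)\<^sup>2 \<partial>lborel) + (\<integral>x. (?h x)\<^sup>2 \<partial>lborel)"
    by (rule Bochner_Integration.integral_add)
       (auto simp: power2_eq_square indicator_inter_arith[symmetric] intro!: integrable_real_indicator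
          simp: emeasure_lborel_Icc_eq)
  finally show "(\<integral>\<mu>. Phi a b \<mu> * Phi c d \<mu> \<partial>?R) = 0"
    unfolding eq using 1 2 3 by simp
qed

text \<open>Two of the four products vanish: the boxes are disjoint, and \<open>k c d\<close> is
  supported in \<open>{0..d}\<close>, to the left of \<open>a\<close>. This asymmetry leaves the
  single linear term that becomes \<open>K a c\<close>.\<close>

lemma integral_T_mult:
  assumes order: "0 \<le> c" "c \<le> d" "d < a" "a \<le> b"
  shows "(\<integral>t. T a b t * T c d t \<partial>lborel)
      = (\<integral>t. indicator {c..d} t * k a b t \<partial>lborel) + (\<integral>t. k a b t * k c d t \<partial>lborel)"
proof -
  obtain C where C: "C \<ge> 0" "\<And>x t. x \<le> b \<Longrightarrow> \<bar>L x t\<bar> \<le> C" using L_bound by metis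
  have k: "\<bar>k a b t\<bar> \<le> (b - a) * C" "\<bar>k c d t\<bar> \<le> (d - c) * C" for t
    using order by (auto intro!: abs_k_le C)
  have eq: "T a b t * T c d t = indicator {c..d} t * k a b t + k a b t * k c d t" for t
    using order k_eq_0[of t d c] by (cases "t \<in> {0..d}") (auto simp: T_def indicator_def algebra_simps)
  show ?thesis
    unfolding eq
  proof (rule Bochner_Integration.integral_add)
    show "integrable lborel (\<lambda>t. indicator {c..d} t * k a b t)"
      by (rule integrable_bounded_support[where a = c and b = d and B = "(b - a) * C"])
         (use k C order in \<open>auto simp: indicator_def\<close>)
    show "integrable lborel (\<lambda>t. k a b t * k c d t)"
      by (rule integrable_bounded_support[where a = 0 and b = b and B = "((b - a) * C) * ((d - c) * C)"])
         (use k C order in \<open>auto simp: k_eq_0 abs_mult intro!: mult_mono\<close>)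
  qed
qed

lemma integrable_Phi_mult_cos_moments:
  assumes M: "cos_moments M" and order: "0 \<le> a" "a \<le> b" "0 \<le> c" "c \<le> d"
  shows "integrable M (\<lambda>\<mu>. Phi a b \<mu> * Phi c d \<mu>)"
proof -
  define X where "X = max b d"
  obtain C where C: "C \<ge> 0" "\<And>x \<mu>. 0 \<le> x \<Longrightarrow> x \<le> X \<Longrightarrow> \<bar>phi x \<mu>\<bar> \<le> C * cos_bound X \<mu>"
    using phi_bound by metis
  show ?thesis
  proof (rule integrable_le_cos_bound[OF M, of X])
    fix \<mu>
    have "\<bar>Phi a b \<mu> * Phi c d \<mu>\<bar> \<le> ((b - a) * (C * cos_bound X \<mu>)) * ((d - c) * (C * cos_bound X \<mu>))"
      unfolding abs_mult using order C cos_bound_ge_1[of X \<mu>]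
      by (intro mult_mono abs_Phi_le mult_nonneg_nonneg) (auto simp: X_def)
    then show "\<bar>Phi a b \<mu> * Phi c d \<mu>\<bar> \<le> ((b - a) * C * ((d - c) * C)) * (cos_bound X \<mu>)\<^sup>2"
      by (simp add: power2_eq_square mult_ac)
  qed (use order in \<open>auto simp: X_def\<close>)
qed

lemma box_identity:
  assumes spectral: "spectral_function phi \<rho>"
    and W: "stieltjes_signed_measure (omega_function \<rho>) W"
    and jordan: "jordan_decomposition W P N" and P: "cos_moments P" and N: "cos_moments N"
    and order: "0 \<le> c" "c \<le> d" "d < a" "a \<le> b"
  shows "(\<integral>\<mu>. Phi a b \<mu> * Phi c d \<mu> \<partial>P) - (\<integral>\<mu>. Phi a b \<mu> * Phi c d \<mu> \<partial>N)
    + (\<integral>t. indicator {c..d} t * k a b t \<partial>lborel) + (\<integral>t. k a b t * k c d t \<partial>lborel) = 0"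
proof -
  have mono: "mono \<rho>"
    using spectral by (simp add: spectral_function_def)
  let ?j = "\<lambda>\<mu>. Phi a b \<mu> * Phi c d \<mu>"
  have int: "integrable P ?j" "integrable N ?j"
    using P N order by (auto intro!: integrable_Phi_mult_cos_moments)
  note stieltjes = mono W jordan finite_measure_cos_moments[OF P] finite_measure_cos_moments[OF N]
    _ integrable_Phi_mult[OF spectral order] int
  have j: "?j \<in> borel_measurable borel" by measurable
  have eq: "indicator {0<..} s * ?j (s\<^sup>2)
      = indicator {0<..} s * (cosine_transform (T a b) s * cosine_transform (T c d) s)" for s
    using order by (auto simp: Phi_power2 indicator_def)
  obtain C where C: "C \<ge> 0" "\<And>x t. x \<le> b \<Longrightarrow> \<bar>L x t\<bar> \<le> C" using L_bound by metis
  \<comment> \<open>Parseval's identity was stated with one bound for both functions; both box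
    lengths are at most \<open>b\<close>.\<close>
  have T: "\<bar>T a b t\<bar> \<le> 1 + b * C" "\<bar>T c d t\<bar> \<le> 1 + b * C" for t
  proof -
    have k: "\<bar>k a b t\<bar> \<le> (b - a) * C" "\<bar>k c d t\<bar> \<le> (d - c) * C"
      using order by (auto intro!: abs_k_le C)
    moreover have "(b - a) * C \<le> b * C" "(d - c) * C \<le> b * C"
      using order C by (auto intro!: mult_right_mono)
    ultimately show "\<bar>T a b t\<bar> \<le> 1 + b * C" "\<bar>T c d t\<bar> \<le> 1 + b * C"
      by (auto simp: T_def indicator_def)
  qed
  have "(\<integral>s. indicator {0<..} s * (cosine_transform (T a b) s * cosine_transform (T c d) s) \<partial>lborel)
      = pi / 2 * (\<integral>t. T a b t * T c d t \<partial>lborel)"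
  proof (rule cosine_transform_parseval[OF _ _ T])
    show "integrable lborel
        (\<lambda>s. indicator {0<..} s * (cosine_transform (T a b) s * cosine_transform (T c d) s))"
      using integrable_free_part[OF stieltjes] j unfolding eq by simp
    show "t \<notin> {0..b} \<Longrightarrow> T a b t = 0" "t \<notin> {0..b} \<Longrightarrow> T c d t = 0" for t
      using order by (auto simp: T_eq_0)
    show "t \<notin> {0, c, d} \<Longrightarrow> isCont (T c d) t" for t
      by (rule isCont_T)
  qed auto
  \<comment> \<open>The density constant of the free measure cancels the constant in Parseval's
    identity.\<close>
  then have "2 / pi * (\<integral>s. indicator {0<..} s * (cosine_transform (T a b) s * cosine_transform (T c d) s) \<partial>lborel)
      = (\<integral>t. T a b t * T c d t \<partial>lborel)"
    by (simp add: field_simps)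
  then show ?thesis
    using integral_stieltjes_measure[OF stieltjes, OF j]
    unfolding eq integral_Phi_mult[OF spectral order] integral_T_mult[OF order] by linarith
qed

section \<open>From boxes to points\<close>

lemma average_phi_tendsto:
  assumes d: "\<And>n. d n > 0" "d \<longlonglongrightarrow> 0"
  shows "(\<lambda>n. Phi a (a + d n) \<mu> / d n) \<longlonglongrightarrow> phi a \<mu>"
  unfolding Phi_def
proof (rule average_tendsto[OF _ d(1)])
  fix e :: real
  assume "e > 0"
  then obtain r where r: "r > 0" "\<And>s. \<bar>s - a\<bar> < r \<Longrightarrow> \<bar>phi s \<mu> - phi a \<mu>\<bar> < e"
    using isCont_phi[where x = a and \<mu> = \<mu>] unfolding continuous_at_eps_delta
    by (auto simp: dist_real_def)
  have "eventually (\<lambda>n. d n < r) sequentially"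
    using d(2) r(1) by (rule order_tendstoD)
  then show "eventually (\<lambda>n. \<forall>s\<in>{a..a + d n}. \<bar>phi s \<mu> - phi a \<mu>\<bar> \<le> e) sequentially"
    by eventually_elim (auto intro!: less_imp_le r(2))
qed measurable

lemma average_L_tendsto:
  assumes d: "\<And>n. d n > 0" "d \<longlonglongrightarrow> 0" and "t \<noteq> a"
  shows "(\<lambda>n. k a (a + d n) t / d n) \<longlonglongrightarrow> L a t"
  unfolding k_def
proof (rule average_tendsto[OF _ d(1)])
  fix e :: real
  assume "e > 0"
  then obtain r where r: "r > 0" "\<And>s. \<bar>s - a\<bar> < r \<Longrightarrow> \<bar>L s t - L a t\<bar> < e"
    using isCont_L_fst[OF \<open>t \<noteq> a\<close>] unfolding continuous_at_eps_delta by (auto simp: dist_real_def)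
  have "eventually (\<lambda>n. d n < r) sequentially"
    using d(2) r(1) by (rule order_tendstoD)
  then show "eventually (\<lambda>n. \<forall>s\<in>{a..a + d n}. \<bar>L s t - L a t\<bar> \<le> e) sequentially"
    by eventually_elim (auto intro!: less_imp_le r(2))
qed measurable

text \<open>Both arguments are averaged over boxes shrinking at the same time, so separate
  continuity would not do: joint continuity of the kernel at \<open>(a, c)\<close> is used.\<close>

lemma double_average_L_tendsto:
  assumes d: "\<And>n. d n > 0" "d \<longlonglongrightarrow> 0" and c: "0 \<le> c" "c < a"
  shows "(\<lambda>n. (\<integral>t. indicator {c..c + d n} t * (k a (a + d n) t / d n) \<partial>lborel) / d n) \<longlonglongrightarrow> L a c"
proof (rule average_tendsto[OF _ d(1)])
  fix e :: real
  assume "e > 0"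
  have "\<forall>e>0. \<exists>r>0. \<forall>p\<in>{(x, t). 0 \<le> t \<and> t \<le> x}. dist p (a, c) < r \<longrightarrow>
      dist (case p of (x, t) \<Rightarrow> K x t) (K a c) < e"
    using cont[unfolded continuous_on_iff, rule_format, of "(a, c)"] c by auto
  with \<open>e > 0\<close> obtain r where r: "r > 0"
    "\<And>p. p \<in> {(x, t). 0 \<le> t \<and> t \<le> x} \<Longrightarrow> dist p (a, c) < r \<Longrightarrow>
      dist (case p of (x, t) \<Rightarrow> K x t) (K a c) < e"
    by metis
  have L: "\<bar>L s t - L a c\<bar> \<le> e" if "\<bar>s - a\<bar> < r / 2" "\<bar>t - c\<bar> < r / 2" "0 \<le> t" "t \<le> s" for s t
  proof -
    have "dist (s, t) (a, c) \<le> \<bar>s - a\<bar> + \<bar>t - c\<bar>"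
      using sqrt_sum_squares_le_sum_abs[of "s - a" "t - c"] by (simp add: dist_prod_def dist_real_def)
    then have "dist (s, t) (a, c) < r"
      using that by linarith
    from r(2)[OF _ this] show ?thesis
      using that c by (simp add: L_def dist_real_def)
  qed
  \<comment> \<open>The bound \<open>a - c\<close> keeps the product of the two boxes inside the
    triangle, where \<open>L\<close> is \<open>K\<close>; the bound \<open>r / 2\<close> in each
    coordinate keeps it within distance \<open>r\<close> of \<open>(a, c)\<close>.\<close>
  have "eventually (\<lambda>n. d n < min (r / 2) (a - c)) sequentially"
    using d(2) by (rule order_tendstoD) (use r c in auto)
  then show "eventually (\<lambda>n. \<forall>t\<in>{c..c + d n}. \<bar>k a (a + d n) t / d n - L a c\<bar> \<le> e) sequentially"
  proof eventually_elim
    case (elim n)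
    show ?case
    proof
      fix t
      assume t: "t \<in> {c..c + d n}"
      have "\<bar>k a (a + d n) t - d n * L a c\<bar> \<le> d n * e"
        unfolding k_def using d(1)[of n] elim t c
        by (intro average_bound L) auto
      also have "k a (a + d n) t - d n * L a c = d n * (k a (a + d n) t / d n - L a c)"
        using d(1)[of n] by (simp add: field_simps)
      finally show "\<bar>k a (a + d n) t / d n - L a c\<bar> \<le> e"
        using d(1)[of n] by (simp add: abs_mult)
    qed
  qed
qed measurable

lemma box_integral_tendsto:
  assumes M: "cos_moments M" and d: "\<And>n. d n > 0" "\<And>n. d n \<le> 1" "d \<longlonglongrightarrow> 0"
    and c: "0 \<le> c" "c < a"
  shows "(\<lambda>n. \<integral>\<mu>. (Phi a (a + d n) \<mu> / d n) * (Phi c (c + d n) \<mu> / d n) \<partial>M)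
    \<longlonglongrightarrow> (\<integral>\<mu>. phi a \<mu> * phi c \<mu> \<partial>M)"
proof -
  note [measurable_cong] = sets_cos_moments[OF M]
  \<comment> \<open>Since \<open>d n \<le> 1\<close>, all boxes lie in \<open>{0..a + 1}\<close>, so
    one majorant serves for every \<open>n\<close>.\<close>
  let ?X = "a + 1"
  obtain C where C: "C \<ge> 0" "\<And>x \<mu>. 0 \<le> x \<Longrightarrow> x \<le> ?X \<Longrightarrow> \<bar>phi x \<mu>\<bar> \<le> C * cos_bound ?X \<mu>"
    using phi_bound by metis
  show ?thesis
  proof (rule integral_dominated_convergence)
    show "integrable M (\<lambda>\<mu>. (C * C) * (cos_bound ?X \<mu>)\<^sup>2)"
      using integrable_cos_bound[OF M, of ?X] c by simp
    show "AE \<mu> in M. (\<lambda>n. (Phi a (a + d n) \<mu> / d n) * (Phi c (c + d n) \<mu> / d n)) \<longlonglongrightarrow> phi a \<mu> * phi c \<mu>"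
      by (intro AE_I2 tendsto_mult average_phi_tendsto d)
    show "AE \<mu> in M. norm ((Phi a (a + d n) \<mu> / d n) * (Phi c (c + d n) \<mu> / d n))
        \<le> (C * C) * (cos_bound ?X \<mu>)\<^sup>2" for n
    proof (rule AE_I2)
      fix \<mu>
      have avg: "\<bar>Phi x (x + d n) \<mu> / d n\<bar> \<le> C * cos_bound ?X \<mu>" if "0 \<le> x" "x \<le> a" for x
        using abs_Phi_le[of x "x + d n" ?X \<mu> C] C(2) that d(1,2)[of n]
        by (simp add: abs_mult divide_le_eq mult.commute)
      have "\<bar>(Phi a (a + d n) \<mu> / d n) * (Phi c (c + d n) \<mu> / d n)\<bar>
          \<le> (C * cos_bound ?X \<mu>) * (C * cos_bound ?X \<mu>)"
        unfolding abs_mult[of "Phi a (a + d n) \<mu> / d n"] using avg C(1) c cos_bound_ge_1[of ?X \<mu>]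
        by (intro mult_mono mult_nonneg_nonneg) auto
      then show "norm ((Phi a (a + d n) \<mu> / d n) * (Phi c (c + d n) \<mu> / d n))
          \<le> (C * C) * (cos_bound ?X \<mu>)\<^sup>2"
        by (simp add: power2_eq_square mult_ac)
    qed
  qed auto
qed

lemma kernel_integral_tendsto:
  assumes d: "\<And>n. d n > 0" "\<And>n. d n \<le> 1" "d \<longlonglongrightarrow> 0" and c: "0 \<le> c" "c < a"
  shows "(\<lambda>n. \<integral>t. (k a (a + d n) t / d n) * (k c (c + d n) t / d n) \<partial>lborel)
    \<longlonglongrightarrow> (\<integral>t. L a t * L c t \<partial>lborel)"
proof -
  let ?X = "a + 1"
  obtain C where C: "C \<ge> 0" "\<And>x t. x \<le> ?X \<Longrightarrow> \<bar>L x t\<bar> \<le> C" using L_bound by metis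
  show ?thesis
  proof (rule integral_dominated_convergence)
    show "integrable lborel (\<lambda>t. indicator {0..?X} t * (C * C))"
      by (rule integrable_indicator_Icc_mult)
    show "AE t in lborel. (\<lambda>n. (k a (a + d n) t / d n) * (k c (c + d n) t / d n)) \<longlonglongrightarrow> L a t * L c t"
      using AE_lborel_singleton[of a] AE_lborel_singleton[of c]
      by eventually_elim (intro tendsto_mult average_L_tendsto d, auto)
    show "AE t in lborel. norm ((k a (a + d n) t / d n) * (k c (c + d n) t / d n))
        \<le> indicator {0..?X} t * (C * C)" for n
    proof (rule AE_I2)
      fix t
      have avg: "\<bar>k x (x + d n) t / d n\<bar> \<le> C" if "x \<le> a" for x
        using abs_k_le[of x "x + d n" C t] C(2) that d(1,2)[of n]
        by (simp add: abs_mult divide_le_eq mult.commute)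
      have "\<bar>(k a (a + d n) t / d n) * (k c (c + d n) t / d n)\<bar> \<le> C * C"
        unfolding abs_mult[of "k a (a + d n) t / d n"] using avg C(1) c by (intro mult_mono) auto
      moreover have "k a (a + d n) t = 0" if "t \<notin> {0..?X}"
        using that d(2)[of n] by (intro k_eq_0) auto
      ultimately show "norm ((k a (a + d n) t / d n) * (k c (c + d n) t / d n))
          \<le> indicator {0..?X} t * (C * C)"
        by (cases "t \<in> {0..?X}") auto
    qed
  qed auto
qed

lemma pointwise_identity:
  assumes spectral: "spectral_function phi \<rho>"
    and W: "stieltjes_signed_measure (omega_function \<rho>) W"
    and jordan: "jordan_decomposition W P N" and P: "cos_moments P" and N: "cos_moments N"
    and c: "0 \<le> c" "c < a"
  shows "(\<integral>\<mu>. phi a \<mu> * phi c \<mu> \<partial>P) - (\<integral>\<mu>. phi a \<mu> * phi c \<mu> \<partial>N)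
    + L a c + (\<integral>t. L a t * L c t \<partial>lborel) = 0"
proof -
  define d where "d n = inverse (real (Suc n))" for n
  have d: "d n > 0" "d n \<le> 1" for n
    by (auto simp: d_def inverse_le_1_iff)
  have d0: "d \<longlonglongrightarrow> 0"
    unfolding d_def by (rule LIMSEQ_inverse_real_of_nat)
  let ?Z = "\<lambda>n. (\<integral>\<mu>. (Phi a (a + d n) \<mu> / d n) * (Phi c (c + d n) \<mu> / d n) \<partial>P)
      - (\<integral>\<mu>. (Phi a (a + d n) \<mu> / d n) * (Phi c (c + d n) \<mu> / d n) \<partial>N)
      + (\<integral>t. indicator {c..c + d n} t * (k a (a + d n) t / d n) \<partial>lborel) / d n
      + (\<integral>t. (k a (a + d n) t / d n) * (k c (c + d n) t / d n) \<partial>lborel)"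
  have "?Z \<longlonglongrightarrow> (\<integral>\<mu>. phi a \<mu> * phi c \<mu> \<partial>P) - (\<integral>\<mu>. phi a \<mu> * phi c \<mu> \<partial>N)
    + L a c + (\<integral>t. L a t * L c t \<partial>lborel)"
    by (intro tendsto_add tendsto_diff box_integral_tendsto[OF P] box_integral_tendsto[OF N]
        double_average_L_tendsto kernel_integral_tendsto d d0 c)
  moreover have "eventually (\<lambda>n. ?Z n = 0) sequentially"
  proof -
    \<comment> \<open>The box identity applies only once the two boxes have separated.\<close>
    have "eventually (\<lambda>n. d n < a - c) sequentially"
      using d0 by (rule order_tendstoD) (use c in auto)
    then show ?thesis
    proof eventually_elim
      case (elim n)
      have *: "c \<le> c + d n" "c + d n < a" "a \<le> a + d n"
        using elim d[of n] by auto
      have "?Z n = ((\<integral>\<mu>. Phi a (a + d n) \<mu> * Phi c (c + d n) \<mu> \<partial>P)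
          - (\<integral>\<mu>. Phi a (a + d n) \<mu> * Phi c (c + d n) \<mu> \<partial>N)
          + (\<integral>t. indicator {c..c + d n} t * k a (a + d n) t \<partial>lborel)
          + (\<integral>t. k a (a + d n) t * k c (c + d n) t \<partial>lborel)) / (d n * d n)"
        by (simp add: add_divide_distrib diff_divide_distrib)
      then show ?case
        using box_identity[OF spectral W jordan P N c(1) *] by simp
    qed
  qed
  ultimately have "(\<lambda>n. 0 :: real) \<longlonglongrightarrow> (\<integral>\<mu>. phi a \<mu> * phi c \<mu> \<partial>P) - (\<integral>\<mu>. phi a \<mu> * phi c \<mu> \<partial>N)
    + L a c + (\<integral>t. L a t * L c t \<partial>lborel)"
    using tendsto_cong by fast
  then show ?thesis
    by (simp add: LIMSEQ_const_iff)
qed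

section \<open>The Volterra equation\<close>

lemma integrable_phi_cos:
  assumes M: "cos_moments M" and "0 \<le> x" "0 \<le> y"
  shows "integrable M (\<lambda>\<mu>. phi x \<mu> * cos_sqrt \<mu> y)"
proof -
  obtain C where C: "C \<ge> 0" "\<And>x' \<mu>. 0 \<le> x' \<Longrightarrow> x' \<le> max x y \<Longrightarrow> \<bar>phi x' \<mu>\<bar> \<le> C * cos_bound (max x y) \<mu>"
    using phi_bound by metis
  show ?thesis
  proof (rule integrable_le_cos_bound[OF M, of "max x y"])
    fix \<mu>
    have "\<bar>phi x \<mu> * cos_sqrt \<mu> y\<bar> \<le> (C * cos_bound (max x y) \<mu>) * cos_bound (max x y) \<mu>"
      unfolding abs_mult using assms C cos_bound_ge_1[of "max x y" \<mu>]
      by (intro mult_mono abs_cos_sqrt_le mult_nonneg_nonneg) auto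
    then show "\<bar>phi x \<mu> * cos_sqrt \<mu> y\<bar> \<le> C * (cos_bound (max x y) \<mu>)\<^sup>2"
      by (simp add: power2_eq_square mult_ac)
  qed (use assms in auto)
qed

text \<open>Expanding \<open>phi c\<close> and exchanging integrals expresses the moments of
  \<open>phi a * phi c\<close> through the single unknown function of \<open>t\<close> for which the
  Volterra equation is set up.\<close>

lemma
  assumes M: "cos_moments M" and "0 \<le> a" "0 \<le> c"
  shows integral_phi_phi: "(\<integral>\<mu>. phi a \<mu> * phi c \<mu> \<partial>M) = (\<integral>\<mu>. phi a \<mu> * cos_sqrt \<mu> c \<partial>M)
      + (\<integral>t. L c t * (\<integral>\<mu>. phi a \<mu> * cos_sqrt \<mu> t \<partial>M) \<partial>lborel)"
    and integrable_L_phi_cos: "integrable lborel (\<lambda>t. L c t * (\<integral>\<mu>. phi a \<mu> * cos_sqrt \<mu> t \<partial>M))"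
proof -
  interpret M: finite_measure M by (rule finite_measure_cos_moments[OF M])
  note [measurable_cong] = sets_cos_moments[OF M]
  let ?X = "max a c"
  obtain C where C: "C \<ge> 0" "\<And>x \<mu>. 0 \<le> x \<Longrightarrow> x \<le> ?X \<Longrightarrow> \<bar>phi x \<mu>\<bar> \<le> C * cos_bound ?X \<mu>"
    using phi_bound by metis
  obtain C' where C': "C' \<ge> 0" "\<And>x t. x \<le> ?X \<Longrightarrow> \<bar>L x t\<bar> \<le> C'" using L_bound by metis
  have le: "\<bar>L c t * (phi a \<mu> * cos_sqrt \<mu> t)\<bar>
      \<le> (indicator {0..?X} t * C') * (C * (cos_bound ?X \<mu>)\<^sup>2)" for t \<mu>
  proof (cases "t \<in> {0..c}")
    case True
    have "\<bar>L c t * (phi a \<mu> * cos_sqrt \<mu> t)\<bar> \<le> C' * ((C * cos_bound ?X \<mu>) * cos_bound ?X \<mu>)"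
      unfolding abs_mult using True assms C C' cos_bound_ge_1[of ?X \<mu>]
      by (intro mult_mono abs_cos_sqrt_le mult_nonneg_nonneg) auto
    moreover have "indicator {0..?X} t = (1 :: real)"
      using True by (auto simp: indicator_def)
    ultimately show ?thesis
      by (simp add: power2_eq_square mult_ac)
  qed (use C C' in \<open>auto simp: L_eq_0 indicator_def\<close>)
  have bound: "integrable M (\<lambda>\<mu>. C * (cos_bound ?X \<mu>)\<^sup>2)"
    using integrable_cos_bound[OF M, of ?X] assms by simp
  have meas: "(\<lambda>(t, \<mu>). L c t * (phi a \<mu> * cos_sqrt \<mu> t)) \<in> borel_measurable (lborel \<Otimes>\<^sub>M M)"
    by measurable
  note fubini = lborel.sigma_finite_measure_axioms M.sigma_finite_measure_axioms meas
    integrable_indicator_Icc_mult bound le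
  show "integrable lborel (\<lambda>t. L c t * (\<integral>\<mu>. phi a \<mu> * cos_sqrt \<mu> t \<partial>M))"
    using integrable_product_bound[OF fubini] by simp
  have meas': "(\<lambda>(\<mu>, t). L c t * (phi a \<mu> * cos_sqrt \<mu> t)) \<in> borel_measurable (M \<Otimes>\<^sub>M lborel)"
    by measurable
  have "integrable M (\<lambda>\<mu>. \<integral>t. L c t * (phi a \<mu> * cos_sqrt \<mu> t) \<partial>lborel)"
    by (rule integrable_product_bound[OF M.sigma_finite_measure_axioms lborel.sigma_finite_measure_axioms
          meas' bound integrable_indicator_Icc_mult[of 0 ?X C']])
       (use le in \<open>simp add: mult.commute\<close>)
  moreover have eq: "phi a \<mu> * phi c \<mu> = phi a \<mu> * cos_sqrt \<mu> c
      + (\<integral>t. L c t * (phi a \<mu> * cos_sqrt \<mu> t) \<partial>lborel)" for \<mu>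
  proof -
    have "(\<integral>t. L c t * (phi a \<mu> * cos_sqrt \<mu> t) \<partial>lborel) = (\<integral>t. phi a \<mu> * (L c t * cos_sqrt \<mu> t) \<partial>lborel)"
      by (simp only: mult.left_commute)
    then show ?thesis
      unfolding phi_def[of c] by (simp add: distrib_left)
  qed
  ultimately have "(\<integral>\<mu>. phi a \<mu> * phi c \<mu> \<partial>M) = (\<integral>\<mu>. phi a \<mu> * cos_sqrt \<mu> c \<partial>M)
      + (\<integral>\<mu>. (\<integral>t. L c t * (phi a \<mu> * cos_sqrt \<mu> t) \<partial>lborel) \<partial>M)"
    unfolding eq using integrable_phi_cos[OF M \<open>0 \<le> a\<close> \<open>0 \<le> c\<close>] by simp
  also have "(\<integral>\<mu>. (\<integral>t. L c t * (phi a \<mu> * cos_sqrt \<mu> t) \<partial>lborel) \<partial>M)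
      = (\<integral>t. L c t * (\<integral>\<mu>. phi a \<mu> * cos_sqrt \<mu> t \<partial>M) \<partial>lborel)"
    using Fubini_product_bound[OF fubini] by simp
  finally show "(\<integral>\<mu>. phi a \<mu> * phi c \<mu> \<partial>M) = (\<integral>\<mu>. phi a \<mu> * cos_sqrt \<mu> c \<partial>M)
      + (\<integral>t. L c t * (\<integral>\<mu>. phi a \<mu> * cos_sqrt \<mu> t \<partial>M) \<partial>lborel)" .
qed

text \<open>The a priori bound from which the Volterra iteration starts.\<close>

lemma abs_integral_phi_cos_le:
  assumes M: "cos_moments M"
  obtains B where "\<And>t. 0 \<le> t \<Longrightarrow> t \<le> a \<Longrightarrow> \<bar>\<integral>\<mu>. phi a \<mu> * cos_sqrt \<mu> t \<partial>M\<bar> \<le> B"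
proof (cases "a \<ge> 0")
  case True
  obtain C where C: "C \<ge> 0" "\<And>x \<mu>. 0 \<le> x \<Longrightarrow> x \<le> a \<Longrightarrow> \<bar>phi x \<mu>\<bar> \<le> C * cos_bound a \<mu>"
    using phi_bound by metis
  have "\<bar>\<integral>\<mu>. phi a \<mu> * cos_sqrt \<mu> t \<partial>M\<bar> \<le> (\<integral>\<mu>. C * (cos_bound a \<mu>)\<^sup>2 \<partial>M)" if t: "0 \<le> t" "t \<le> a" for t
  proof -
    have "\<bar>\<integral>\<mu>. phi a \<mu> * cos_sqrt \<mu> t \<partial>M\<bar> \<le> (\<integral>\<mu>. \<bar>phi a \<mu> * cos_sqrt \<mu> t\<bar> \<partial>M)"
      by (rule integral_abs_bound)
    also have "\<dots> \<le> (\<integral>\<mu>. C * (cos_bound a \<mu>)\<^sup>2 \<partial>M)"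
    proof (rule integral_mono)
      show "integrable M (\<lambda>\<mu>. \<bar>phi a \<mu> * cos_sqrt \<mu> t\<bar>)"
        using integrable_phi_cos[OF M True t(1)] by (rule integrable_abs)
      show "integrable M (\<lambda>\<mu>. C * (cos_bound a \<mu>)\<^sup>2)"
        using integrable_cos_bound[OF M True] by simp
      fix \<mu>
      have "\<bar>phi a \<mu> * cos_sqrt \<mu> t\<bar> \<le> (C * cos_bound a \<mu>) * cos_bound a \<mu>"
        unfolding abs_mult using True t C cos_bound_ge_1[of a \<mu>]
        by (intro mult_mono abs_cos_sqrt_le mult_nonneg_nonneg) auto
      then show "\<bar>phi a \<mu> * cos_sqrt \<mu> t\<bar> \<le> C * (cos_bound a \<mu>)\<^sup>2"
        by (simp add: power2_eq_square mult_ac)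
    qed
    finally show ?thesis .
  qed
  then show thesis by (rule that)
next
  case False
  then show thesis by (intro that[of 0]) auto
qed

text \<open>
  For \<open>y < x\<close> the difference of the two sides solves a homogeneous Volterra equation in \<open>y\<close>.
\<close>

lemma integral_phi_cos_lt:
  assumes spectral: "spectral_function phi \<rho>"
    and W: "stieltjes_signed_measure (omega_function \<rho>) W"
    and jordan: "jordan_decomposition W P N" and P: "cos_moments P" and N: "cos_moments N"
    and y: "0 \<le> y" "y < x"
  shows "(\<integral>\<mu>. phi x \<mu> * cos_sqrt \<mu> y \<partial>P) - (\<integral>\<mu>. phi x \<mu> * cos_sqrt \<mu> y \<partial>N) = - L x y"
proof -
  interpret P: finite_measure P by (rule finite_measure_cos_moments[OF P])
  interpret N: finite_measure N by (rule finite_measure_cos_moments[OF N])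
  note [measurable_cong] = sets_cos_moments[OF P] sets_cos_moments[OF N]
  define wP where "wP t = (\<integral>\<mu>. phi x \<mu> * cos_sqrt \<mu> t \<partial>P)" for t
  define wN where "wN t = (\<integral>\<mu>. phi x \<mu> * cos_sqrt \<mu> t \<partial>N)" for t
  define u where "u t = wP t - wN t + L x t" for t
  have [measurable]: "u \<in> borel_measurable borel"
    unfolding u_def wP_def wN_def by measurable
  obtain C where C: "C \<ge> 0" "\<And>x' t. x' \<le> x \<Longrightarrow> \<bar>L x' t\<bar> \<le> C" using L_bound by metis
  obtain BP BN where B: "\<And>t. 0 \<le> t \<Longrightarrow> t \<le> x \<Longrightarrow> \<bar>wP t\<bar> \<le> BP" "\<And>t. 0 \<le> t \<Longrightarrow> t \<le> x \<Longrightarrow> \<bar>wN t\<bar> \<le> BN"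
    using abs_integral_phi_cos_le[OF P, of x] abs_integral_phi_cos_le[OF N, of x]
    unfolding wP_def wN_def by metis
  have bound: "\<bar>u t\<bar> \<le> BP + BN + C" if "0 \<le> t" "t \<le> x" for t
    using B[OF that] C(2)[of x t] unfolding u_def by linarith
  have "u y = 0"
  proof (rule volterra_inequality_zero[OF _ C(1) bound _ y])
    fix c
    assume c: "0 \<le> c" "c < x"
    have LL: "integrable lborel (\<lambda>t. L x t * L c t)"
      by (rule integrable_bounded_support[where a = 0 and b = x and B = "C * C"])
         (use C c in \<open>auto simp: L_eq_0 abs_mult intro!: mult_mono\<close>)
    have x: "0 \<le> x"
      using c by simp
    have int': "integrable lborel (\<lambda>t. L c t * wP t)" "integrable lborel (\<lambda>t. L c t * wN t)"
      using integrable_L_phi_cos[OF P x c(1)] integrable_L_phi_cos[OF N x c(1)]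
      unfolding wP_def wN_def by auto
    have Lu: "L c t * u t = L c t * wP t - L c t * wN t + L x t * L c t" for t
      unfolding u_def by (simp add: algebra_simps)
    have Lu_int: "integrable lborel (\<lambda>t. L c t * u t)"
      unfolding Lu using int' LL by auto
    have "(\<integral>t. L c t * u t \<partial>lborel)
        = (\<integral>t. L c t * wP t \<partial>lborel) - (\<integral>t. L c t * wN t \<partial>lborel) + (\<integral>t. L x t * L c t \<partial>lborel)"
      unfolding Lu using int' LL by simp
    moreover have "(wP c + (\<integral>t. L c t * wP t \<partial>lborel)) - (wN c + (\<integral>t. L c t * wN t \<partial>lborel))
        + L x c + (\<integral>t. L x t * L c t \<partial>lborel) = 0"
      using pointwise_identity[OF spectral W jordan P N c]
      unfolding integral_phi_phi[OF P x c(1)] integral_phi_phi[OF N x c(1)] wP_def wN_def .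
    \<comment> \<open>\<open>L c\<close> vanishes beyond \<open>c\<close>, so the integral sees
      \<open>u\<close> only on \<open>{0..c}\<close>: a Volterra equation in \<open>c\<close>, with
      \<open>x\<close> as a mere parameter.\<close>
    ultimately have "u c = - (\<integral>t. L c t * u t \<partial>lborel)"
      unfolding u_def[of c] by linarith
    then have "\<bar>u c\<bar> \<le> (\<integral>t. \<bar>L c t * u t\<bar> \<partial>lborel)"
      by simp
    also have "\<dots> \<le> (\<integral>t. C * (indicator {0..c} t * \<bar>u t\<bar>) \<partial>lborel)"
    proof (rule integral_mono)
      show "integrable lborel (\<lambda>t. \<bar>L c t * u t\<bar>)"
        by (rule integrable_abs[OF Lu_int])
      show "integrable lborel (\<lambda>t. C * (indicator {0..c} t * \<bar>u t\<bar>))"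
        by (intro integrable_mult_right,
            rule integrable_bounded_support[where a = 0 and b = c and B = "BP + BN + C"])
           (use c bound order_trans[OF abs_ge_zero bound[of 0]] in \<open>auto simp: indicator_def\<close>)
      show "\<bar>L c t * u t\<bar> \<le> C * (indicator {0..c} t * \<bar>u t\<bar>)" for t
        using C(2)[of c t] c L_eq_0[of t c] by (cases "t \<in> {0..c}") (auto simp: abs_mult intro!: mult_right_mono)
    qed
    finally show "\<bar>u c\<bar> \<le> C * (\<integral>t. indicator {0..c} t * \<bar>u t\<bar> \<partial>lborel)"
      by simp
  qed auto
  then show ?thesis
    by (simp add: u_def wP_def wN_def)
qed

lemma integral_phi_cos_tendsto:
  assumes M: "cos_moments M" and "0 \<le> x" "0 \<le> y" "y \<le> x"
    and d: "\<And>n. 0 \<le> d n" "\<And>n. d n \<le> 1" "d \<longlonglongrightarrow> 0"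
  shows "(\<lambda>n. \<integral>\<mu>. phi (x + d n) \<mu> * cos_sqrt \<mu> y \<partial>M) \<longlonglongrightarrow> (\<integral>\<mu>. phi x \<mu> * cos_sqrt \<mu> y \<partial>M)"
proof -
  note [measurable_cong] = sets_cos_moments[OF M]
  let ?X = "x + 1"
  obtain C where C: "C \<ge> 0" "\<And>x \<mu>. 0 \<le> x \<Longrightarrow> x \<le> ?X \<Longrightarrow> \<bar>phi x \<mu>\<bar> \<le> C * cos_bound ?X \<mu>"
    using phi_bound by metis
  have lim: "(\<lambda>n. x + d n) \<longlonglongrightarrow> x"
    using tendsto_add[OF tendsto_const d(3)] by simp
  show ?thesis
  proof (rule integral_dominated_convergence)
    show "integrable M (\<lambda>\<mu>. C * (cos_bound ?X \<mu>)\<^sup>2)"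
      using integrable_cos_bound[OF M, of ?X] assms by simp
    show "AE \<mu> in M. (\<lambda>n. phi (x + d n) \<mu> * cos_sqrt \<mu> y) \<longlonglongrightarrow> phi x \<mu> * cos_sqrt \<mu> y"
      by (intro AE_I2 tendsto_mult_right isCont_tendsto_compose[OF isCont_phi lim])
    show "AE \<mu> in M. norm (phi (x + d n) \<mu> * cos_sqrt \<mu> y) \<le> C * (cos_bound ?X \<mu>)\<^sup>2" for n
    proof (rule AE_I2)
      fix \<mu>
      have "\<bar>phi (x + d n) \<mu> * cos_sqrt \<mu> y\<bar> \<le> (C * cos_bound ?X \<mu>) * cos_bound ?X \<mu>"
        unfolding abs_mult using assms(2-4) d(1,2)[of n] C cos_bound_ge_1[of ?X \<mu>]
        by (intro mult_mono abs_cos_sqrt_le mult_nonneg_nonneg) auto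
      then show "norm (phi (x + d n) \<mu> * cos_sqrt \<mu> y) \<le> C * (cos_bound ?X \<mu>)\<^sup>2"
        by (simp add: power2_eq_square mult_ac)
    qed
  qed auto
qed

text \<open>Approaching \<open>x\<close> from the right gives \<open>y < x + d n\<close> also when
  \<open>y = x\<close>, so the strict case applies along the whole sequence.\<close>

lemma integral_phi_cos:
  assumes spectral: "spectral_function phi \<rho>"
    and W: "stieltjes_signed_measure (omega_function \<rho>) W"
    and jordan: "jordan_decomposition W P N" and P: "cos_moments P" and N: "cos_moments N"
    and y: "0 \<le> y" "y \<le> x"
  shows "(\<integral>\<mu>. phi x \<mu> * cos_sqrt \<mu> y \<partial>P) - (\<integral>\<mu>. phi x \<mu> * cos_sqrt \<mu> y \<partial>N) = - K x y"
proof -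
  define d where "d n = inverse (real (Suc n))" for n
  have d: "0 < d n" "d n \<le> 1" for n
    by (auto simp: d_def inverse_le_1_iff)
  have d0: "d \<longlonglongrightarrow> 0"
    unfolding d_def by (rule LIMSEQ_inverse_real_of_nat)
  have "(\<lambda>n. (\<integral>\<mu>. phi (x + d n) \<mu> * cos_sqrt \<mu> y \<partial>P) - (\<integral>\<mu>. phi (x + d n) \<mu> * cos_sqrt \<mu> y \<partial>N))
      \<longlonglongrightarrow> (\<integral>\<mu>. phi x \<mu> * cos_sqrt \<mu> y \<partial>P) - (\<integral>\<mu>. phi x \<mu> * cos_sqrt \<mu> y \<partial>N)"
    using y d by (intro tendsto_diff integral_phi_cos_tendsto P N d0) (auto intro: less_imp_le)
  moreover have "(\<integral>\<mu>. phi (x + d n) \<mu> * cos_sqrt \<mu> y \<partial>P) - (\<integral>\<mu>. phi (x + d n) \<mu> * cos_sqrt \<mu> y \<partial>N)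
      = - K (x + d n) y" for n
    using integral_phi_cos_lt[OF spectral W jordan P N y(1), of "x + d n"] y d(1)[of n]
    by (simp add: L_def)
  moreover have "(\<lambda>n. - K (x + d n) y) \<longlonglongrightarrow> - K x y"
  proof (intro tendsto_minus)
    have "((\<lambda>(x, t). K x t) \<longlongrightarrow> K x y) (at (x, y) within {(x, t). 0 \<le> t \<and> t \<le> x})"
      using cont y unfolding continuous_on_def by force
    moreover have "(\<lambda>n. (x + d n, y)) \<longlonglongrightarrow> (x, y)"
      using tendsto_add[OF tendsto_const d0, of x] by (intro tendsto_Pair) auto
    then have "filterlim (\<lambda>n. (x + d n, y)) (at (x, y) within {(x, t). 0 \<le> t \<and> t \<le> x}) sequentially"
    proof -
      have "y \<le> x + d n" "d n \<noteq> 0" for n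
        using y d(1)[of n] by auto
      with \<open>(\<lambda>n. (x + d n, y)) \<longlonglongrightarrow> (x, y)\<close> show ?thesis
        using y by (simp add: filterlim_at)
    qed
    ultimately have "(\<lambda>n. (\<lambda>(x, t). K x t) (x + d n, y)) \<longlonglongrightarrow> K x y"
      by (rule filterlim_compose)
    then show "(\<lambda>n. K (x + d n) y) \<longlonglongrightarrow> K x y"
      by simp
  qed
  ultimately show ?thesis
    using LIMSEQ_unique by fastforce
qed

end

theorem lemma3p1:
  fixes q \<rho> :: "real \<Rightarrow> real"
    and \<phi> K F f :: "real \<Rightarrow> real \<Rightarrow> real"
    and W :: "real set \<Rightarrow> ereal"
  assumes q: "continuous_on {0..} q"
    and phi: "\<And>\<mu>. solves_ivp q \<mu> (\<lambda>x. \<phi> x \<mu>)"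
    and rho: "spectral_function \<phi> \<rho>"
    and W: "stieltjes_signed_measure (omega_function \<rho>) W"
    and F: "\<And>x y. x \<ge> 0 \<Longrightarrow> y \<ge> 0 \<Longrightarrow>
              has_signed_integral W (\<lambda>\<mu>. sinc_sqrt \<mu> x * sinc_sqrt \<mu> y) (F x y)"
    and F_f: "mixed_partial F f"
    and f: "\<And>x y. x \<ge> 0 \<Longrightarrow> y \<ge> 0 \<Longrightarrow>
              has_signed_integral W (\<lambda>\<mu>. cos_sqrt \<mu> x * cos_sqrt \<mu> y) (f x y)"
    and K: "gelfand_levitan_kernel \<phi> K"
  shows "\<forall>x y. 0 \<le> y \<and> y \<le> x \<longrightarrow>
           has_signed_integral W (\<lambda>\<mu>. \<phi> x \<mu> * cos_sqrt \<mu> y) (- K x y)"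
proof -
  interpret volterra_kernel K
    by standard (use K in \<open>simp add: gelfand_levitan_kernel_def\<close>)
  have phi_eq: "\<phi> x \<mu> = phi x \<mu>" if "x \<ge> 0" for x \<mu>
  proof -
    have "(LBINT t:{0..x}. K x t * cos_sqrt \<mu> t) = (\<integral>t. L x t * cos_sqrt \<mu> t \<partial>lborel)"
      unfolding set_lebesgue_integral_def
      by (rule Bochner_Integration.integral_cong) (auto simp: L_def indicator_def)
    then show ?thesis
      using K that by (simp add: gelfand_levitan_kernel_def phi_def)
  qed
  \<comment> \<open>\<open>spectral_function\<close> evaluates its first argument only at
    \<open>x \<ge> 0\<close>, so \<open>\<phi>\<close> may be replaced by \<open>phi\<close>
    there.\<close>
  have "(LBINT x:{0..real n}. g x * \<phi> x \<mu>) = (LBINT x:{0..real n}. g x * phi x \<mu>)" for g n \<mu>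
    by (rule set_lebesgue_integral_cong) (auto simp: phi_eq)
  then have spectral: "spectral_function phi \<rho>"
    using rho by (simp add: spectral_function_def)
  \<comment> \<open>Fix the decomposition that comes with \<open>f 0 0\<close>; uniqueness transfers
    the integrability at every other \<open>X\<close> to it.\<close>
  obtain P N where jordan: "jordan_decomposition W P N"
    using f[of 0 0] by (auto simp: has_signed_integral_def)
  have "integrable P (\<lambda>\<mu>. cos_sqrt \<mu> X * cos_sqrt \<mu> X) \<and> integrable N (\<lambda>\<mu>. cos_sqrt \<mu> X * cos_sqrt \<mu> X)"
    if "X \<ge> 0" for X
    using f[OF that that] jordan_decomposition_unique[OF jordan] by (auto simp: has_signed_integral_def)
  then have P: "cos_moments P" and N: "cos_moments N"
    using jordan by (auto simp: cos_moments_def jordan_decomposition_def)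
  show ?thesis
  proof (intro allI impI)
    fix x y :: real
    assume y: "0 \<le> y \<and> y \<le> x"
    then have "integrable P (\<lambda>\<mu>. phi x \<mu> * cos_sqrt \<mu> y)" "integrable N (\<lambda>\<mu>. phi x \<mu> * cos_sqrt \<mu> y)"
      by (auto intro!: integrable_phi_cos P N)
    moreover have "- K x y = (\<integral>\<mu>. phi x \<mu> * cos_sqrt \<mu> y \<partial>P) - (\<integral>\<mu>. phi x \<mu> * cos_sqrt \<mu> y \<partial>N)"
      using integral_phi_cos[OF spectral W jordan P N] y by simp
    ultimately show "has_signed_integral W (\<lambda>\<mu>. \<phi> x \<mu> * cos_sqrt \<mu> y) (- K x y)"
      using jordan y unfolding has_signed_integral_def by (auto simp: phi_eq)
  qed
qed

end
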